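(* Let $(\mathcal{P},\eta,K)$ be a para-Hermitian manifold, let $B:T_+\to T_-$ be a bundle map with $\eta(BX,Y)=-\eta(X,BY)$ for all $X,Y\in\Gamma(T_+)$, and let $(K_B,\eta)$ be the corresponding $B$-transformation of $(K,\eta)$. Then $K_B$ is compatible with $K$ (i.e. both eigenbundles of $K_B$ are involutive under the D-bracket of $(K,\eta)$) if and only if $$d_+b_++(\Lambda^3\eta)[b_-,b_-]_-=0 .$$
   Context: An almost para-Hermitian manifold $(\mathcal{P},\eta,K)$ is a manifold with $K\in\mathrm{End}(T\mathcal{P})$, $K^2=\mathbb{1}$, whose $\pm1$-eigenbundles $T_\pm$ have the same rank, and a pseudo-Riemannian metric $\eta$ with $\eta(K\cdot,K\cdot)=-\eta$. Then $T\mathcal{P}=T_+\oplus T_-$ and $T_\pm$ are maximally isotropic. It is para-Hermitian if both $T_+$ and $T_-$ are Frobenius integrable. Write $X=x_++x_-$ with $x_\pm\in T_\pm$. Adapted connection: a connection $\nabla$ on $T\mathcal{P}$ with torsion $T^\nabla$ such that (1) $\nabla_{x_+}\eta=0$; (2) $\nabla_{x_+}y_-\in\Gamma(T_-)$; (3) $\eta(T^\nabla(x_+,y_+),z_-)=0$; (4) $\eta(T^\nabla(x_+,y_+),z_+)+\eta(\nabla_{z_+}x_+,y_+)=0$, for all sections $x_+,y_+,z_+$ of $T_+$ and $y_-,z_-$ of $T_-$, and such that (1)–(4) also hold with the roles of $T_+,T_-$ exchanged. The D-bracket of $(\mathcal{P},\eta,K)$ is defined by $\eta([\![X,Y]\!]^D,Z)=\eta(\nabla_XY-\nabla_YX,Z)+\eta(\nabla_ZX,Y)$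 for an adapted connection $\nabla$; on a para-Hermitian manifold the result does not depend on the choice of $\nabla$, and one adapted connection is the canonical connection $\nabla^c_XY=\mathrm{P}_+\mathring\nabla_X\mathrm{P}_+Y+\mathrm{P}_-\mathring\nabla_X\mathrm{P}_-Y$, where $\mathrm{P}_\pm=\frac12(\mathbb{1}\pm K)$ and $\mathring\nabla$ is the Levi-Civita connection of $\eta$. $B$-transformation: in the splitting $T_+\oplus T_-$, $e^B=\begin{pmatrix}\mathbb{1}&0\\ B&\mathbb{1}\end{pmatrix}$ and $K_B=e^BKe^{-B}=\begin{pmatrix}\mathbb{1}&0\\ 2B&-\mathbb{1}\end{pmatrix}$; $(K_B,\eta)$ is again an almost para-Hermitian structure. $B$ (extended by zero on $T_-$) is encoded by the two-form $b_+\in\Gamma(\Lambda^2T_+^* )$ and the bivector $b_-\in\Gamma(\Lambda^2T_-)$ with $\eta(BX,Y)=b_+(X,Y)=b_-(\eta(X),\eta(Y))$, where $\eta(X)=\eta(X,\cdot)$. $d_+$ is the Lie algebroid differential of the Lie algebroid $T_+$ (leafwise de Rham differential), and $[\ ,\ ]_-$ is the Schouten bracket of the Lie algebroid $T_-$, normalized so that $[b_-,b_-]_-(\lambda,\mu,\nu)=\sum_{\mathrm{Cycl.}\,\lambda,\mu,\nu}(\nabla_{b_-(\lambda)}b_-)(\mu,\nu)$ for $\lambda,\mu,\nu\in\Gamma(T_-^* )$, with $\nabla$ any torsionless connection on $T_-$ (along its leaves) and $b_-(\lambda)=b_-(\lambda,\cdot)$ (so that $b_-(\eta(X))=BX$).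 The three-form $(\Lambda^3\eta)[b_-,b_-]_-\in\Gamma(\Lambda^3T_+^* )$ is $(X,Y,Z)\mapsto[b_-,b_-]_-(\eta(X),\eta(Y),\eta(Z))$. *)

theory Defs
  imports "HOL-Analysis.Analysis" "HOL-Library.Function_Algebras"
begin

section \<open>Smooth manifolds\<close>

text \<open>
  A \<open>C\<^sup>k\<close> function on an open set; the successor step asks for a (total) derivative all of whose
  directional derivatives are \<open>C\<^sup>k\<close>.
\<close>

primrec Ck_on :: "nat \<Rightarrow> 'e::real_normed_vector set \<Rightarrow> ('e \<Rightarrow> 'f::real_normed_vector) \<Rightarrow> bool" where
  "Ck_on 0 S f \<longleftrightarrow> continuous_on S f"
| "Ck_on (Suc k) S f \<longleftrightarrow>
     f differentiable_on S \<and> (\<forall>v. Ck_on k S (\<lambda>x. frechet_derivative f (at x) v))"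

definition Cinf_on :: "'e::real_normed_vector set \<Rightarrow> ('e \<Rightarrow> 'f::real_normed_vector) \<Rightarrow> bool" where
  "Cinf_on S f \<longleftrightarrow> (\<forall>k. Ck_on k S f)"

text \<open>
  A manifold is a topological space together with a smooth atlas modelled on the Euclidean space
  \<open>'e\<close>; its points are the elements of \<open>topspace (fst M)\<close>.
\<close>

type_synonym ('a, 'e) manifold = "'a topology \<times> ('a set \<times> ('a \<Rightarrow> 'e)) set"

definition smooth_manifold :: "('a, 'e::euclidean_space) manifold \<Rightarrow> bool" where
  "smooth_manifold M \<longleftrightarrow>
     Hausdorff_space (fst M) \<and> second_countable (fst M) \<and>
     topspace (fst M) = (\<Union>(U, \<phi>) \<in> snd M. U) \<and>
     (\<forall>(U, \<phi>) \<in> snd M. openin (fst M) U \<and> open (\<phi> ` U) \<and>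
        homeomorphic_map (subtopology (fst M) U) (top_of_set (\<phi> ` U)) \<phi>) \<and>
     (\<forall>(U, \<phi>) \<in> snd M. \<forall>(V, \<psi>) \<in> snd M.
        Cinf_on (\<phi> ` (U \<inter> V)) (\<psi> \<circ> inv_into U \<phi>))"

text \<open>
  The algebra \<open>C\<^sup>\<infinity>(M)\<close>. Functions are extended by zero off the manifold, so that equality of
  functions is equality in HOL; ring operations on functions are the pointwise ones.
\<close>

definition smooth_fun :: "('a, 'e::euclidean_space) manifold \<Rightarrow> ('a \<Rightarrow> real) set" where
  "smooth_fun M = {f. (\<forall>(U, \<phi>) \<in> snd M. Cinf_on (\<phi> ` U) (f \<circ> inv_into U \<phi>)) \<and>
                      (\<forall>p. p \<notin> topspace (fst M) \<longrightarrow> f p = 0)}"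


section \<open>Vector fields and tensor fields\<close>

text \<open>
  A vector field is a derivation of \<open>C\<^sup>\<infinity>(M)\<close> (extended by zero to non-smooth functions); its value
  at \<open>p\<close> is the tangent vector \<open>f \<mapsto> (X f)(p)\<close>. Tensor fields and bundle maps are given by their
  action on sections, that is, as \<open>C\<^sup>\<infinity>(M)\<close>-multilinear maps; a subbundle of the tangent bundle is
  given by its \<open>C\<^sup>\<infinity>(M)\<close>-module of sections.
\<close>

type_synonym 'a vfield = "('a \<Rightarrow> real) \<Rightarrow> ('a \<Rightarrow> real)"
type_synonym 'a form1 = "'a vfield \<Rightarrow> ('a \<Rightarrow> real)"

definition vector_fields :: "('a, 'e::euclidean_space) manifold \<Rightarrow> 'a vfield set" where
  "vector_fields M = {X.
     (\<forall>f \<in> smooth_fun M. X f \<in> smooth_fun M) \<and>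
     (\<forall>f. f \<notin> smooth_fun M \<longrightarrow> X f = 0) \<and>
     (\<forall>f \<in> smooth_fun M. \<forall>g \<in> smooth_fun M. X (f + g) = X f + X g) \<and>
     (\<forall>c. \<forall>f \<in> smooth_fun M. X (\<lambda>p. c * f p) = (\<lambda>p. c * X f p)) \<and>
     (\<forall>f \<in> smooth_fun M. \<forall>g \<in> smooth_fun M. X (f * g) = X f * g + f * X g)}"

definition fun_smult :: "('a \<Rightarrow> real) \<Rightarrow> 'a vfield \<Rightarrow> 'a vfield" (infixr "\<cdot>\<^sub>v" 70) where
  "f \<cdot>\<^sub>v X = (\<lambda>g. f * X g)"

definition lie_bracket :: "'a vfield \<Rightarrow> 'a vfield \<Rightarrow> 'a vfield" where
  "lie_bracket X Y = (\<lambda>f. X (Y f) - Y (X f))"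

text \<open>The fibre at \<open>p\<close> of the subbundle with sections \<open>L\<close>, and its dimension.\<close>

definition fibre :: "'a vfield set \<Rightarrow> 'a \<Rightarrow> (('a \<Rightarrow> real) \<Rightarrow> real) set" where
  "fibre L p = (\<lambda>X f. X f p) ` L"

definition rank_at :: "'a vfield set \<Rightarrow> 'a \<Rightarrow> nat" where
  "rank_at L p =
     vector_space.dim (\<lambda>(c::real) (v :: ('a \<Rightarrow> real) \<Rightarrow> real). \<lambda>f. c * v f) (fibre L p)"

definition bundle_maps ::
  "('a, 'e::euclidean_space) manifold \<Rightarrow> 'a vfield set \<Rightarrow> 'a vfield set \<Rightarrow> ('a vfield \<Rightarrow> 'a vfield) set"
  where
  "bundle_maps M L L' = {A.
     (\<forall>X \<in> L. A X \<in> L') \<and>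
     (\<forall>X \<in> L. \<forall>Y \<in> L. A (X + Y) = A X + A Y) \<and>
     (\<forall>f \<in> smooth_fun M. \<forall>X \<in> L. A (f \<cdot>\<^sub>v X) = f \<cdot>\<^sub>v A X)}"

text \<open>Sections of the dual bundle of the bundle with sections \<open>L\<close>, extended by zero off \<open>L\<close>.\<close>

definition dual_sections ::
  "('a, 'e::euclidean_space) manifold \<Rightarrow> 'a vfield set \<Rightarrow> 'a form1 set" where
  "dual_sections M L = {\<alpha>.
     (\<forall>X \<in> L. \<alpha> X \<in> smooth_fun M) \<and>
     (\<forall>X. X \<notin> L \<longrightarrow> \<alpha> X = 0) \<and>
     (\<forall>X \<in> L. \<forall>Y \<in> L. \<alpha> (X + Y) = \<alpha> X + \<alpha> Y) \<and>
     (\<forall>f \<in> smooth_fun M. \<forall>X \<in> L. \<alpha> (f \<cdot>\<^sub>v X) = f * \<alpha> X)}"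

definition restrict_form :: "'a vfield set \<Rightarrow> 'a form1 \<Rightarrow> 'a form1" where
  "restrict_form L \<alpha> = (\<lambda>X. if X \<in> L then \<alpha> X else 0)"

text \<open>
  A pseudo-Riemannian metric: a symmetric \<open>(0,2)\<close>-tensor field which is non-degenerate, i.e. the
  bundle map \<open>TM \<rightarrow> T\<^sup>*M\<close>, \<open>X \<mapsto> \<eta>(X, \<cdot>)\<close>, is an isomorphism.
\<close>

definition pseudo_riemannian ::
  "('a, 'e::euclidean_space) manifold \<Rightarrow> ('a vfield \<Rightarrow> 'a form1) \<Rightarrow> bool" where
  "pseudo_riemannian M \<eta> \<longleftrightarrow>
     (\<forall>X \<in> vector_fields M. \<forall>Y \<in> vector_fields M. \<eta> X Y = \<eta> Y X) \<and>
     (\<forall>X \<in> vector_fields M. restrict_form (vector_fields M) (\<eta> X) \<in> dual_sections M (vector_fields M)) \<and>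
     bij_betw (\<lambda>X. restrict_form (vector_fields M) (\<eta> X))
       (vector_fields M) (dual_sections M (vector_fields M))"


section \<open>Para-Hermitian structures\<close>

definition plus_sections ::
  "('a, 'e::euclidean_space) manifold \<Rightarrow> ('a vfield \<Rightarrow> 'a vfield) \<Rightarrow> 'a vfield set" where
  "plus_sections M K = {X \<in> vector_fields M. K X = X}"

definition minus_sections ::
  "('a, 'e::euclidean_space) manifold \<Rightarrow> ('a vfield \<Rightarrow> 'a vfield) \<Rightarrow> 'a vfield set" where
  "minus_sections M K = {X \<in> vector_fields M. K X = - X}"

definition almost_para_hermitian ::
  "('a, 'e::euclidean_space) manifold \<Rightarrow> ('a vfield \<Rightarrow> 'a form1) \<Rightarrow> ('a vfield \<Rightarrow> 'a vfield) \<Rightarrow> bool"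
  where
  "almost_para_hermitian M \<eta> K \<longleftrightarrow>
     K \<in> bundle_maps M (vector_fields M) (vector_fields M) \<and>
     (\<forall>X \<in> vector_fields M. K (K X) = X) \<and>
     (\<forall>p \<in> topspace (fst M). rank_at (plus_sections M K) p = rank_at (minus_sections M K) p) \<and>
     pseudo_riemannian M \<eta> \<and>
     (\<forall>X \<in> vector_fields M. \<forall>Y \<in> vector_fields M. \<eta> (K X) (K Y) = - \<eta> X Y)"

definition involutive :: "('a vfield \<Rightarrow> 'a vfield \<Rightarrow> 'a vfield) \<Rightarrow> 'a vfield set \<Rightarrow> bool" where
  "involutive br L \<longleftrightarrow> (\<forall>X \<in> L. \<forall>Y \<in> L. br X Y \<in> L)"

definition para_hermitian ::
  "('a, 'e::euclidean_space) manifold \<Rightarrow> ('a vfield \<Rightarrow> 'a form1) \<Rightarrow> ('a vfield \<Rightarrow> 'a vfield) \<Rightarrow> bool"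
  where
  "para_hermitian M \<eta> K \<longleftrightarrow>
     almost_para_hermitian M \<eta> K \<and>
     involutive lie_bracket (plus_sections M K) \<and>
     involutive lie_bracket (minus_sections M K)"


section \<open>Connections and the D-bracket\<close>

text \<open>
  A connection on a Lie algebroid \<open>L\<close> along itself, where \<open>L\<close> is (the module of sections of) an
  involutive subbundle of the tangent bundle; \<open>L = vector_fields M\<close> gives affine connections.
\<close>

definition connection_on ::
  "('a, 'e::euclidean_space) manifold \<Rightarrow> 'a vfield set \<Rightarrow> ('a vfield \<Rightarrow> 'a vfield \<Rightarrow> 'a vfield) \<Rightarrow> bool"
  where
  "connection_on M L D \<longleftrightarrow>
     (\<forall>Y \<in> L. (\<lambda>X. D X Y) \<in> bundle_maps M L L) \<and>
     (\<forall>X \<in> L. \<forall>Y \<in> L. \<forall>Z \<in> L. D X (Y + Z) = D X Y + D X Z) \<and>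
     (\<forall>f \<in> smooth_fun M. \<forall>X \<in> L. \<forall>Y \<in> L. D X (f \<cdot>\<^sub>v Y) = X f \<cdot>\<^sub>v Y + f \<cdot>\<^sub>v D X Y)"

definition torsion ::
  "('a vfield \<Rightarrow> 'a vfield \<Rightarrow> 'a vfield) \<Rightarrow> 'a vfield \<Rightarrow> 'a vfield \<Rightarrow> 'a vfield" where
  "torsion D X Y = D X Y - D Y X - lie_bracket X Y"

text \<open>Conditions (1)--(4) for an adapted connection, with \<open>L, L'\<close> in the roles of \<open>T\<^sub>+, T\<^sub>-\<close>.\<close>

definition half_adapted ::
  "('a, 'e::euclidean_space) manifold \<Rightarrow> ('a vfield \<Rightarrow> 'a form1) \<Rightarrow> 'a vfield set \<Rightarrow> 'a vfield set \<Rightarrow>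
   ('a vfield \<Rightarrow> 'a vfield \<Rightarrow> 'a vfield) \<Rightarrow> bool" where
  "half_adapted M \<eta> L L' D \<longleftrightarrow>
     (\<forall>X \<in> L. \<forall>Y \<in> vector_fields M. \<forall>Z \<in> vector_fields M.
        X (\<eta> Y Z) - \<eta> (D X Y) Z - \<eta> Y (D X Z) = 0) \<and>
     (\<forall>X \<in> L. \<forall>Y \<in> L'. D X Y \<in> L') \<and>
     (\<forall>X \<in> L. \<forall>Y \<in> L. \<forall>Z \<in> L'. \<eta> (torsion D X Y) Z = 0) \<and>
     (\<forall>X \<in> L. \<forall>Y \<in> L. \<forall>Z \<in> L. \<eta> (torsion D X Y) Z + \<eta> (D Z X) Y = 0)"

definition adapted_connection ::
  "('a, 'e::euclidean_space) manifold \<Rightarrow> ('a vfield \<Rightarrow> 'a form1) \<Rightarrow> ('a vfield \<Rightarrow> 'a vfield) \<Rightarrow>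
   ('a vfield \<Rightarrow> 'a vfield \<Rightarrow> 'a vfield) \<Rightarrow> bool" where
  "adapted_connection M \<eta> K D \<longleftrightarrow>
     connection_on M (vector_fields M) D \<and>
     half_adapted M \<eta> (plus_sections M K) (minus_sections M K) D \<and>
     half_adapted M \<eta> (minus_sections M K) (plus_sections M K) D"

text \<open>
  The definite description is legitimate: on a para-Hermitian manifold adapted connections exist,
  and all of them yield the same bracket.
\<close>

definition D_bracket ::
  "('a, 'e::euclidean_space) manifold \<Rightarrow> ('a vfield \<Rightarrow> 'a form1) \<Rightarrow> ('a vfield \<Rightarrow> 'a vfield) \<Rightarrow>
   'a vfield \<Rightarrow> 'a vfield \<Rightarrow> 'a vfield" where
  "D_bracket M \<eta> K X Y = (THE W. W \<in> vector_fields M \<and>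
     (\<exists>D. adapted_connection M \<eta> K D \<and>
        (\<forall>Z \<in> vector_fields M. \<eta> W Z = \<eta> (D X Y - D Y X) Z + \<eta> (D Z X) Y)))"

text \<open>Compatibility of \<open>K'\<close> with the para-Hermitian structure \<open>(K, \<eta>)\<close>.\<close>

definition compatible ::
  "('a, 'e::euclidean_space) manifold \<Rightarrow> ('a vfield \<Rightarrow> 'a form1) \<Rightarrow> ('a vfield \<Rightarrow> 'a vfield) \<Rightarrow>
   ('a vfield \<Rightarrow> 'a vfield) \<Rightarrow> bool" where
  "compatible M \<eta> K K' \<longleftrightarrow>
     involutive (D_bracket M \<eta> K) (plus_sections M K') \<and>
     involutive (D_bracket M \<eta> K) (minus_sections M K')"


section \<open>B-transformations\<close>

definition proj_plus :: "('a vfield \<Rightarrow> 'a vfield) \<Rightarrow> 'a vfield \<Rightarrow> 'a vfield" where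
  "proj_plus K X = (\<lambda>f p. (X f p + K X f p) / 2)"

text \<open>
  \<open>B\<close> is defined on the sections of \<open>T\<^sub>+\<close> and extended by zero on \<open>T\<^sub>-\<close>; hence \<open>e\<^sup>B = 1 + B P\<^sub>+\<close>.
\<close>

definition exp_B :: "('a vfield \<Rightarrow> 'a vfield) \<Rightarrow> ('a vfield \<Rightarrow> 'a vfield) \<Rightarrow> 'a vfield \<Rightarrow> 'a vfield"
  where
  "exp_B K B X = X + B (proj_plus K X)"

definition B_transform ::
  "('a vfield \<Rightarrow> 'a vfield) \<Rightarrow> ('a vfield \<Rightarrow> 'a vfield) \<Rightarrow> 'a vfield \<Rightarrow> 'a vfield" where
  "B_transform K B X = exp_B K B (K (exp_B K (\<lambda>Y. - B Y) X))"

definition b_plus ::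
  "('a vfield \<Rightarrow> 'a form1) \<Rightarrow> ('a vfield \<Rightarrow> 'a vfield) \<Rightarrow> 'a vfield \<Rightarrow> 'a form1" where
  "b_plus \<eta> B X Y = \<eta> (B X) Y"

text \<open>
  The isomorphism \<open>T\<^sub>+ \<rightarrow> T\<^sub>-\<^sup>*\<close>, \<open>X \<mapsto> \<eta>(X, \<cdot>)\<close>, and the bivector \<open>b\<^sub>-\<close> as a bilinear form on
  \<open>\<Gamma>(T\<^sub>-\<^sup>*)\<close>, determined by \<open>b\<^sub>-(\<eta>(X), \<eta>(Y)) = b\<^sub>+(X, Y)\<close>.
\<close>

definition flat_plus ::
  "('a, 'e::euclidean_space) manifold \<Rightarrow> ('a vfield \<Rightarrow> 'a form1) \<Rightarrow> ('a vfield \<Rightarrow> 'a vfield) \<Rightarrow>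
   'a vfield \<Rightarrow> 'a form1" where
  "flat_plus M \<eta> K X = restrict_form (minus_sections M K) (\<eta> X)"

definition b_minus ::
  "('a, 'e::euclidean_space) manifold \<Rightarrow> ('a vfield \<Rightarrow> 'a form1) \<Rightarrow> ('a vfield \<Rightarrow> 'a vfield) \<Rightarrow>
   ('a vfield \<Rightarrow> 'a vfield) \<Rightarrow> 'a form1 \<Rightarrow> 'a form1 \<Rightarrow> ('a \<Rightarrow> real)" where
  "b_minus M \<eta> K B \<alpha> \<beta> =
     b_plus \<eta> B (inv_into (plus_sections M K) (flat_plus M \<eta> K) \<alpha>)
                (inv_into (plus_sections M K) (flat_plus M \<eta> K) \<beta>)"


section \<open>Lie algebroid differential and Schouten bracket\<close>

text \<open>The Lie algebroid differential of a two-form (no combinatorial prefactor).\<close>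

definition d_two_form ::
  "('a vfield \<Rightarrow> 'a form1) \<Rightarrow> 'a vfield \<Rightarrow> 'a vfield \<Rightarrow> 'a vfield \<Rightarrow> ('a \<Rightarrow> real)" where
  "d_two_form \<omega> X Y Z =
     X (\<omega> Y Z) - Y (\<omega> X Z) + Z (\<omega> X Y)
     - \<omega> (lie_bracket X Y) Z + \<omega> (lie_bracket X Z) Y - \<omega> (lie_bracket Y Z) X"

text \<open>
  For a bivector \<open>\<pi>\<close> on a Lie algebroid \<open>L\<close>: the section \<open>\<pi>(\<alpha>) = \<pi>(\<alpha>, \<cdot>)\<close> of \<open>L = L\<^sup>*\<^sup>*\<close>, and the
  covariant derivatives of one-forms and of \<open>\<pi>\<close> along a connection on \<open>L\<close>.
\<close>

definition contract ::
  "('a, 'e::euclidean_space) manifold \<Rightarrow> 'a vfield set \<Rightarrow>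
   ('a form1 \<Rightarrow> 'a form1 \<Rightarrow> ('a \<Rightarrow> real)) \<Rightarrow> 'a form1 \<Rightarrow> 'a vfield" where
  "contract M L \<pi> \<alpha> = (THE W. W \<in> L \<and> (\<forall>\<mu> \<in> dual_sections M L. \<mu> W = \<pi> \<alpha> \<mu>))"

definition cov_form ::
  "'a vfield set \<Rightarrow> ('a vfield \<Rightarrow> 'a vfield \<Rightarrow> 'a vfield) \<Rightarrow> 'a vfield \<Rightarrow> 'a form1 \<Rightarrow> 'a form1" where
  "cov_form L D X \<mu> = restrict_form L (\<lambda>Y. X (\<mu> Y) - \<mu> (D X Y))"

definition cov_bivector ::
  "'a vfield set \<Rightarrow> ('a vfield \<Rightarrow> 'a vfield \<Rightarrow> 'a vfield) \<Rightarrow> 'a vfield \<Rightarrow>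
   ('a form1 \<Rightarrow> 'a form1 \<Rightarrow> ('a \<Rightarrow> real)) \<Rightarrow> 'a form1 \<Rightarrow> 'a form1 \<Rightarrow> ('a \<Rightarrow> real)" where
  "cov_bivector L D X \<pi> \<mu> \<nu> = X (\<pi> \<mu> \<nu>) - \<pi> (cov_form L D X \<mu>) \<nu> - \<pi> \<mu> (cov_form L D X \<nu>)"

definition torsionless_connection_on ::
  "('a, 'e::euclidean_space) manifold \<Rightarrow> 'a vfield set \<Rightarrow> ('a vfield \<Rightarrow> 'a vfield \<Rightarrow> 'a vfield) \<Rightarrow> bool"
  where
  "torsionless_connection_on M L D \<longleftrightarrow>
     connection_on M L D \<and> (\<forall>X \<in> L. \<forall>Y \<in> L. torsion D X Y = 0)"

text \<open>
  The Schouten bracket \<open>[\<pi>, \<pi>]\<close>, normalized as the cyclic sum of \<open>(D\<^bsub>\<pi>(\<alpha>)\<^esub> \<pi>)(\<mu>, \<nu>)\<close>; the value does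
  not depend on the torsionless connection.
\<close>

definition schouten_square ::
  "('a, 'e::euclidean_space) manifold \<Rightarrow> 'a vfield set \<Rightarrow>
   ('a form1 \<Rightarrow> 'a form1 \<Rightarrow> ('a \<Rightarrow> real)) \<Rightarrow> 'a form1 \<Rightarrow> 'a form1 \<Rightarrow> 'a form1 \<Rightarrow> ('a \<Rightarrow> real)" where
  "schouten_square M L \<pi> \<alpha> \<mu> \<nu> = (THE h. \<exists>D. torsionless_connection_on M L D \<and>
     h = cov_bivector L D (contract M L \<pi> \<alpha>) \<pi> \<mu> \<nu>
       + cov_bivector L D (contract M L \<pi> \<mu>) \<pi> \<nu> \<alpha>
       + cov_bivector L D (contract M L \<pi> \<nu>) \<pi> \<alpha> \<mu>)"

end

theory Submission
  imports Defs
begin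

text \<open>
  Koszul's formula and the non-degeneracy of \<open>\<eta>\<close> give the Levi-Civita connection, so the canonical
  connection exists and is adapted. For every adapted connection the trilinear form
  \<open>\<eta>(\<lbrakk>X, Y\<rbrakk>\<^sup>D, Z)\<close> takes, on arguments from \<open>T\<^sub>+\<close> and \<open>T\<^sub>-\<close>, values expressed by \<open>\<eta>\<close> and Lie brackets
  only; hence the D-bracket is well defined. The \<open>-1\<close>-eigenbundle of \<open>K\<^sub>B\<close> is \<open>T\<^sub>-\<close>, on which the
  D-bracket is the Lie bracket. The \<open>+1\<close>-eigenbundle is the graph of \<open>B\<close>, which is its own orthogonal
  complement, so it is involutive iff \<open>\<eta>(\<lbrakk>X + B X, Y + B Y\<rbrakk>\<^sup>D, Z + B Z) = 0\<close> for all \<open>X, Y, Z\<close> in \<open>T\<^sub>+\<close>.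
  Of the eight terms in the expansion, those with one \<open>B\<close> add up to \<open>d\<^sub>+b\<^sub>+\<close>, those with two to
  \<open>[b\<^sub>-, b\<^sub>-]\<^sub>-\<close>, and those with none or three vanish.
\<close>

section \<open>The algebra of smooth functions\<close>

text \<open>Since \<open>S\<close> is open, functions that agree on \<open>S\<close> have the same
  derivatives at its points. This allows the derivative of a sum or product, known by a formula on
  \<open>S\<close> only, to be exchanged for that formula under \<open>Ck_on\<close>.\<close>

lemma Ck_on_cong:
  assumes "open S" and "\<And>x. x \<in> S \<Longrightarrow> f x = g x" and "Ck_on k S f"
  shows "Ck_on k S g"
  using assms(2,3)
proof (induction k arbitrary: f g)
  case 0
  then show ?case by (simp cong: continuous_on_cong)
next
  case (Suc k)
  have df: "f differentiable at x" if "x \<in> S" for x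
    using Suc.prems(2) assms(1) that by (simp add: differentiable_on_eq_differentiable_at)
  have dg: "(g has_derivative frechet_derivative f (at x)) (at x)" if "x \<in> S" for x
    using df[OF that, unfolded frechet_derivative_works] assms(1) that
    by (rule has_derivative_transform_within_open) (use Suc.prems(1) in auto)
  have "Ck_on k S (\<lambda>x. frechet_derivative g (at x) v)" for v
    by (rule Suc.IH[of "\<lambda>x. frechet_derivative f (at x) v"])
      (use Suc.prems(2) frechet_derivative_at[OF dg] in auto)
  with dg assms(1) show ?case
    by (auto simp: differentiable_on_eq_differentiable_at differentiable_def)
qed

lemma Ck_on_const: "Ck_on k S (\<lambda>x. c)"
  by (induction k arbitrary: c) (auto simp: continuous_on_const)

lemma Ck_on_Suc_imp: "Ck_on (Suc k) S f \<Longrightarrow> Ck_on k S f"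
  by (induction k arbitrary: f) (auto simp: differentiable_imp_continuous_on)

lemma Ck_on_add:
  assumes "open S" "Ck_on k S f" "Ck_on k S g"
  shows "Ck_on k S (\<lambda>x. f x + g x)"
  using assms(2,3)
proof (induction k arbitrary: f g)
  case 0
  then show ?case by (simp add: continuous_on_add)
next
  case (Suc k)
  have d: "((\<lambda>x. f x + g x) has_derivative
      (\<lambda>v. frechet_derivative f (at x) v + frechet_derivative g (at x) v)) (at x)" if "x \<in> S" for x
    using Suc.prems assms(1) that
    by (auto simp: differentiable_on_eq_differentiable_at frechet_derivative_works
        intro!: has_derivative_add)
  have "Ck_on k S (\<lambda>x. frechet_derivative (\<lambda>x. f x + g x) (at x) v)" for v
    by (rule Ck_on_cong[OF assms(1) _ Suc.IH[of "\<lambda>x. frechet_derivative f (at x) v" "\<lambda>x. frechet_derivative g (at x) v"]])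
      (use Suc.prems frechet_derivative_at[OF d, symmetric] in auto)
  with d assms(1) show ?case
    by (auto simp: differentiable_on_eq_differentiable_at differentiable_def)
qed

text \<open>The Leibniz formula contains \<open>f\<close> and \<open>g\<close> themselves beside
  their derivatives; \<open>Ck_on_Suc_imp\<close> lowers them to the order at which the induction
  hypothesis for products applies.\<close>

lemma Ck_on_mult:
  fixes f g :: "'e::real_normed_vector \<Rightarrow> real"
  assumes "open S" "Ck_on k S f" "Ck_on k S g"
  shows "Ck_on k S (\<lambda>x. f x * g x)"
  using assms(2,3)
proof (induction k arbitrary: f g)
  case 0
  then show ?case by (simp add: continuous_on_mult)
next
  case (Suc k)
  have d: "((\<lambda>x. f x * g x) has_derivative
      (\<lambda>v. f x * frechet_derivative g (at x) v + frechet_derivative f (at x) v * g x)) (at x)"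
    if "x \<in> S" for x
    using Suc.prems assms(1) that
    by (auto simp: differentiable_on_eq_differentiable_at frechet_derivative_works
        intro!: has_derivative_mult)
  have "Ck_on k S (\<lambda>x. f x * frechet_derivative g (at x) v + frechet_derivative f (at x) v * g x)" for v
    by (intro Ck_on_add assms(1) Suc.IH) (use Suc.prems Ck_on_Suc_imp in auto)
  then have "Ck_on k S (\<lambda>x. frechet_derivative (\<lambda>x. f x * g x) (at x) v)" for v
    by (rule Ck_on_cong[OF assms(1), rotated]) (use frechet_derivative_at[OF d, symmetric] in auto)
  with d assms(1) show ?case
    by (auto simp: differentiable_on_eq_differentiable_at differentiable_def)
qed

text \<open>Identities with a factor 2, such as Koszul's formula, are kept in doubled form below;
  this cancels the factor.\<close>

lemma double_cancel_fun: "(f :: 'a \<Rightarrow> real) + f = g + g \<Longrightarrow> f = g"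
  by (simp add: fun_eq_iff)

lemma double_cancel_vfield: "(X :: 'a vfield) + X = Y + Y \<Longrightarrow> X = Y"
  by (simp add: fun_eq_iff)

locale manifold =
  fixes M :: "('a, 'e::euclidean_space) manifold"
  assumes smooth_manifold: "smooth_manifold M"
begin

abbreviation "C \<equiv> smooth_fun M"
abbreviation "VF \<equiv> vector_fields M"

lemma open_chart: "(U, \<phi>) \<in> snd M \<Longrightarrow> open (\<phi> ` U)"
  using smooth_manifold unfolding smooth_manifold_def by blast

lemma smooth_chart: "f \<in> C \<Longrightarrow> (U, \<phi>) \<in> snd M \<Longrightarrow> Ck_on k (\<phi> ` U) (\<lambda>x. f (inv_into U \<phi> x))"
  unfolding smooth_fun_def Cinf_on_def comp_def by blast

lemma smooth_outside: "f \<in> C \<Longrightarrow> p \<notin> topspace (fst M) \<Longrightarrow> f p = 0"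
  unfolding smooth_fun_def by blast

lemma smoothI:
  assumes "\<And>U \<phi> k. (U, \<phi>) \<in> snd M \<Longrightarrow> Ck_on k (\<phi> ` U) (\<lambda>x. f (inv_into U \<phi> x))"
    and "\<And>p. p \<notin> topspace (fst M) \<Longrightarrow> f p = 0"
  shows "f \<in> C"
  using assms unfolding smooth_fun_def Cinf_on_def comp_def by blast

lemma smooth_zero [simp]: "0 \<in> C"
  by (rule smoothI) (simp_all add: Ck_on_const)

lemma smooth_add [simp]: "f \<in> C \<Longrightarrow> g \<in> C \<Longrightarrow> f + g \<in> C"
  by (rule smoothI) (simp_all add: Ck_on_add open_chart smooth_chart smooth_outside)

lemma smooth_mult [simp]: "f \<in> C \<Longrightarrow> g \<in> C \<Longrightarrow> f * g \<in> C"
  by (rule smoothI) (simp_all add: Ck_on_mult open_chart smooth_chart smooth_outside)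

lemma smooth_scale [simp]: "f \<in> C \<Longrightarrow> (\<lambda>p. c * f p) \<in> C"
  by (rule smoothI) (simp_all add: Ck_on_mult Ck_on_const open_chart smooth_chart smooth_outside)

lemma smooth_uminus [simp]: "f \<in> C \<Longrightarrow> - f \<in> C"
  using smooth_scale[of f "-1"] by (simp add: fun_Compl_def)

lemma smooth_diff [simp]: "f \<in> C \<Longrightarrow> g \<in> C \<Longrightarrow> f - g \<in> C"
  using smooth_add[of f "- g"] by simp

lemma smooth_half [simp]: "f \<in> C \<Longrightarrow> (\<lambda>p. f p / 2) \<in> C"
  using smooth_scale[of f "1/2"] by simp


section \<open>The module of vector fields\<close>

context
  fixes X assumes X: "X \<in> VF"
begin

lemma vf_smooth: "f \<in> C \<Longrightarrow> X f \<in> C"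
  and vf_nonsmooth: "f \<notin> C \<Longrightarrow> X f = 0"
  and vf_add: "f \<in> C \<Longrightarrow> g \<in> C \<Longrightarrow> X (f + g) = X f + X g"
  and vf_scale: "f \<in> C \<Longrightarrow> X (\<lambda>p. c * f p) = (\<lambda>p. c * X f p)"
  and vf_mult: "f \<in> C \<Longrightarrow> g \<in> C \<Longrightarrow> X (f * g) = X f * g + f * X g"
  using X by (auto simp: vector_fields_def)

lemma vf_zero: "X 0 = 0"
  using vf_add[of 0 0] by simp

lemma vf_uminus: "f \<in> C \<Longrightarrow> X (- f) = - X f"
  using vf_scale[of f "-1"] by (simp add: fun_Compl_def)

lemma vf_diff: "f \<in> C \<Longrightarrow> g \<in> C \<Longrightarrow> X (f - g) = X f - X g"
  using vf_add[of f "- g"] vf_uminus[of g] by simp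

end

text \<open>
  The head variable \<open>X\<close> makes these unreliable as global simp rules; they are used only after
  instantiating their premise.
\<close>

lemmas vf_simps = vf_smooth vf_nonsmooth vf_add vf_scale vf_mult vf_zero vf_uminus vf_diff

lemma VF_I:
  assumes "\<And>f. f \<in> C \<Longrightarrow> X f \<in> C" "\<And>f. f \<notin> C \<Longrightarrow> X f = 0"
    "\<And>f g. f \<in> C \<Longrightarrow> g \<in> C \<Longrightarrow> X (f + g) = X f + X g"
    "\<And>c f. f \<in> C \<Longrightarrow> X (\<lambda>p. c * f p) = (\<lambda>p. c * X f p)"
    "\<And>f g. f \<in> C \<Longrightarrow> g \<in> C \<Longrightarrow> X (f * g) = X f * g + f * X g"
  shows "X \<in> VF"
  using assms unfolding vector_fields_def by blast

lemma VF_zero [simp]: "0 \<in> VF"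
  by (rule VF_I) (simp_all add: fun_eq_iff)

lemma VF_add [simp]: assumes "X \<in> VF" "Y \<in> VF" shows "X + Y \<in> VF"
  by (rule VF_I) (simp_all add: vf_simps[OF assms(1)] vf_simps[OF assms(2)] algebra_simps,
    simp add: fun_eq_iff algebra_simps)

lemma VF_smult [simp]: assumes "f \<in> C" "X \<in> VF" shows "f \<cdot>\<^sub>v X \<in> VF"
  by (rule VF_I) (use assms(1) in \<open>simp_all add: fun_smult_def vf_simps[OF assms(2)] algebra_simps\<close>,
    simp add: fun_eq_iff algebra_simps)

lemma VF_uminus [simp]: assumes "X \<in> VF" shows "- X \<in> VF"
  by (rule VF_I) (simp_all add: vf_simps[OF assms] algebra_simps, simp add: fun_eq_iff)

lemma VF_diff [simp]: "X \<in> VF \<Longrightarrow> Y \<in> VF \<Longrightarrow> X - Y \<in> VF"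
  using VF_add[of X "- Y"] by simp

lemma VF_half [simp]: assumes "X \<in> VF" shows "(\<lambda>f p. X f p / 2) \<in> VF"
  by (rule VF_I) (simp_all add: vf_simps[OF assms], simp_all add: fun_eq_iff add_divide_distrib)

lemma VF_lie [simp]: assumes "X \<in> VF" "Y \<in> VF" shows "lie_bracket X Y \<in> VF"
  by (rule VF_I) (simp_all add: lie_bracket_def vf_simps[OF assms(1)] vf_simps[OF assms(2)] algebra_simps,
    simp add: fun_eq_iff algebra_simps)

lemma smult_apply [simp]: "(f \<cdot>\<^sub>v X) g = f * X g"
  by (simp add: fun_smult_def)

lemma smult_add_right: "f \<cdot>\<^sub>v (X + Y) = f \<cdot>\<^sub>v X + f \<cdot>\<^sub>v Y"
  by (auto simp: fun_smult_def algebra_simps)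

lemma lie_antisym: "lie_bracket X Y = - lie_bracket Y X"
  by (auto simp: lie_bracket_def)

lemma lie_add_right:
  assumes "X \<in> VF" "Y \<in> VF" "Z \<in> VF"
  shows "lie_bracket X (Y + Z) = lie_bracket X Y + lie_bracket X Z"
proof
  fix f
  \<comment> \<open>Additivity of a derivation is available on smooth functions only; on all other
    functions both sides vanish by the extension by zero.\<close>
  show "lie_bracket X (Y + Z) f = (lie_bracket X Y + lie_bracket X Z) f"
    by (cases "f \<in> C") (simp_all add: lie_bracket_def assms[THEN vf_smooth]
        assms[THEN vf_nonsmooth] assms[THEN vf_zero] assms[THEN vf_add])
qed

lemma lie_add_left:
  assumes "X \<in> VF" "Y \<in> VF" "Z \<in> VF"
  shows "lie_bracket (X + Y) Z = lie_bracket X Z + lie_bracket Y Z"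
  using lie_add_right[OF assms(3,1,2)] lie_antisym[of "X + Y" Z] lie_antisym[of X Z] lie_antisym[of Y Z]
  by simp

lemma lie_smult_right:
  assumes "X \<in> VF" "Y \<in> VF" "f \<in> C"
  shows "lie_bracket X (f \<cdot>\<^sub>v Y) = X f \<cdot>\<^sub>v Y + f \<cdot>\<^sub>v lie_bracket X Y"
proof
  fix g
  show "lie_bracket X (f \<cdot>\<^sub>v Y) g = (X f \<cdot>\<^sub>v Y + f \<cdot>\<^sub>v lie_bracket X Y) g"
    using assms(3) by (cases "g \<in> C")
      (simp_all add: lie_bracket_def algebra_simps vf_simps[OF assms(1)] vf_simps[OF assms(2)])
qed

lemma lie_smult_left:
  assumes "X \<in> VF" "Y \<in> VF" "f \<in> C"
  shows "lie_bracket (f \<cdot>\<^sub>v X) Y = f \<cdot>\<^sub>v lie_bracket X Y - Y f \<cdot>\<^sub>v X"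
proof
  fix g
  show "lie_bracket (f \<cdot>\<^sub>v X) Y g = (f \<cdot>\<^sub>v lie_bracket X Y - Y f \<cdot>\<^sub>v X) g"
    using assms(3) by (cases "g \<in> C")
      (simp_all add: lie_bracket_def algebra_simps vf_simps[OF assms(1)] vf_simps[OF assms(2)])
qed

end

section \<open>The Levi-Civita connection\<close>

locale pseudo_riemannian_manifold = manifold M
  for M :: "('a, 'e::euclidean_space) manifold" +
  fixes \<eta> :: "'a vfield \<Rightarrow> 'a form1"
  assumes metric: "pseudo_riemannian M \<eta>"
begin

section \<open>Bilinearity and non-degeneracy of the metric\<close>

lemma eta_sym: "X \<in> VF \<Longrightarrow> Y \<in> VF \<Longrightarrow> \<eta> X Y = \<eta> Y X"
  using metric unfolding pseudo_riemannian_def by blast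

context
  fixes X assumes X: "X \<in> VF"
begin

lemma eta_dual: "restrict_form VF (\<eta> X) \<in> dual_sections M VF"
  using metric X unfolding pseudo_riemannian_def by blast

lemma eta_smooth [simp]: "Y \<in> VF \<Longrightarrow> \<eta> X Y \<in> C"
  using eta_dual unfolding dual_sections_def restrict_form_def by auto

lemma eta_add_right [simp]: "Y \<in> VF \<Longrightarrow> Z \<in> VF \<Longrightarrow> \<eta> X (Y + Z) = \<eta> X Y + \<eta> X Z"
  using eta_dual unfolding dual_sections_def restrict_form_def by auto

lemma eta_smult_right [simp]: "f \<in> C \<Longrightarrow> Y \<in> VF \<Longrightarrow> \<eta> X (f \<cdot>\<^sub>v Y) = f * \<eta> X Y"
  using eta_dual unfolding dual_sections_def restrict_form_def by auto

lemma eta_zero_right [simp]: "\<eta> X 0 = 0"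
  using eta_add_right[of 0 0] by simp

lemma eta_uminus_right [simp]: "Y \<in> VF \<Longrightarrow> \<eta> X (- Y) = - \<eta> X Y"
  using eta_add_right[of Y "- Y"] by (simp add: eq_neg_iff_add_eq_0 add.commute)

lemma eta_diff_right [simp]: "Y \<in> VF \<Longrightarrow> Z \<in> VF \<Longrightarrow> \<eta> X (Y - Z) = \<eta> X Y - \<eta> X Z"
  using eta_add_right[of Y "- Z"] by simp

lemma eta_add_left [simp]: "Y \<in> VF \<Longrightarrow> Z \<in> VF \<Longrightarrow> \<eta> (Y + Z) X = \<eta> Y X + \<eta> Z X"
  using eta_add_right[of Y Z] X by (simp add: eta_sym[of X])

lemma eta_smult_left [simp]: "f \<in> C \<Longrightarrow> Y \<in> VF \<Longrightarrow> \<eta> (f \<cdot>\<^sub>v Y) X = f * \<eta> Y X"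
  using eta_smult_right[of f Y] X by (simp add: eta_sym[of X])

lemma eta_uminus_left [simp]: "Y \<in> VF \<Longrightarrow> \<eta> (- Y) X = - \<eta> Y X"
  using eta_uminus_right[of Y] X by (simp add: eta_sym[of X])

lemma eta_diff_left [simp]: "Y \<in> VF \<Longrightarrow> Z \<in> VF \<Longrightarrow> \<eta> (Y - Z) X = \<eta> Y X - \<eta> Z X"
  using eta_diff_right[of Y Z] X by (simp add: eta_sym[of X])

end

lemma eta_eqI:
  assumes "X \<in> VF" "Y \<in> VF" "\<And>Z. Z \<in> VF \<Longrightarrow> \<eta> X Z = \<eta> Y Z"
  shows "X = Y"
proof -
  have "restrict_form VF (\<eta> X) = restrict_form VF (\<eta> Y)"
    using assms(3) by (auto simp: restrict_form_def)
  then show ?thesis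
    using metric assms(1,2) unfolding pseudo_riemannian_def bij_betw_def inj_on_def by blast
qed

lemma eta_eqI2:
  assumes "X \<in> VF" "Y \<in> VF" "\<And>Z. Z \<in> VF \<Longrightarrow> \<eta> X Z + \<eta> X Z = \<eta> Y Z + \<eta> Y Z"
  shows "X = Y"
  using assms double_cancel_fun by (intro eta_eqI) blast+

lemma eta_represent:
  assumes "\<alpha> \<in> dual_sections M VF"
  obtains W where "W \<in> VF" "\<And>Z. Z \<in> VF \<Longrightarrow> \<eta> W Z = \<alpha> Z"
proof -
  have "\<alpha> \<in> (\<lambda>X. restrict_form VF (\<eta> X)) ` VF"
    using metric assms unfolding pseudo_riemannian_def bij_betw_def by simp
  then show ?thesis
    using that unfolding restrict_form_def by auto
qed

text \<open>The right-hand side of Koszul's formula: twice the pairing with \<open>Z\<close> of the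
  Levi-Civita derivative of \<open>Y\<close> along \<open>X\<close>.\<close>

definition koszul :: "'a vfield \<Rightarrow> 'a vfield \<Rightarrow> 'a form1" where
  "koszul X Y Z = X (\<eta> Y Z) + Y (\<eta> X Z) - Z (\<eta> X Y)
     + \<eta> (lie_bracket X Y) Z - \<eta> (lie_bracket X Z) Y - \<eta> (lie_bracket Y Z) X"

context
  fixes X Y Z assumes XYZ: "X \<in> VF" "Y \<in> VF" "Z \<in> VF"
begin

lemma koszul_smooth: "koszul X Y Z \<in> C"
  using XYZ by (simp add: koszul_def XYZ[THEN vf_smooth])

lemma koszul_add:
  assumes "W \<in> VF"
  shows "koszul X Y (Z + W) = koszul X Y Z + koszul X Y W"
  using XYZ assms by (simp add: koszul_def XYZ[THEN vf_add] lie_add_right)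

text \<open>The terms with \<open>X f\<close> and \<open>Y f\<close> that come from differentiating
  \<open>\<eta>\<close> cancel against those from the brackets with
  \<open>f \<cdot>\<^sub>v Z\<close>. So Koszul's expression is tensorial in \<open>Z\<close>, and
  non-degeneracy can turn it into a vector field.\<close>

lemma koszul_smult:
  assumes f: "f \<in> C"
  shows "koszul X Y (f \<cdot>\<^sub>v Z) = f * koszul X Y Z"
  using XYZ f by (simp add: koszul_def XYZ[THEN vf_mult] XYZ[THEN vf_smooth] lie_smult_right
      eta_sym[of Z X] eta_sym[of Z Y] algebra_simps)

end

lemma levi_civita_ex1:
  assumes "X \<in> VF" "Y \<in> VF"
  shows "\<exists>!W. W \<in> VF \<and> (\<forall>Z \<in> VF. \<eta> W Z + \<eta> W Z = koszul X Y Z)"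
proof -
  \<comment> \<open>Half of Koszul's expression, set to 0 off \<open>VF\<close> as the encoding of
    one-forms in \<open>dual_sections\<close> demands.\<close>
  define \<alpha> where "\<alpha> Z = (if Z \<in> VF then (\<lambda>p. koszul X Y Z p / 2) else 0)" for Z
  have "\<alpha> \<in> dual_sections M VF"
    unfolding dual_sections_def \<alpha>_def using assms
    by (auto simp: koszul_smooth koszul_add koszul_smult fun_eq_iff add_divide_distrib)
  then obtain W where W: "W \<in> VF" "\<And>Z. Z \<in> VF \<Longrightarrow> \<eta> W Z = \<alpha> Z"
    using eta_represent by blast
  show ?thesis
  proof (rule ex1I[of _ W])
    show *: "W \<in> VF \<and> (\<forall>Z \<in> VF. \<eta> W Z + \<eta> W Z = koszul X Y Z)"
      using W(1) by (auto simp: W(2) \<alpha>_def fun_eq_iff)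
    show "V = W" if "V \<in> VF \<and> (\<forall>Z \<in> VF. \<eta> V Z + \<eta> V Z = koszul X Y Z)" for V
      using that * by (intro eta_eqI2) auto
  qed
qed

definition levi_civita :: "'a vfield \<Rightarrow> 'a vfield \<Rightarrow> 'a vfield" where
  "levi_civita X Y = (THE W. W \<in> VF \<and> (\<forall>Z \<in> VF. \<eta> W Z + \<eta> W Z = koszul X Y Z))"

lemma
  assumes "X \<in> VF" "Y \<in> VF"
  shows levi_civita_VF [simp]: "levi_civita X Y \<in> VF"
    and levi_civita_koszul: "Z \<in> VF \<Longrightarrow>
      \<eta> (levi_civita X Y) Z + \<eta> (levi_civita X Y) Z = koszul X Y Z"
  using theI'[OF levi_civita_ex1[OF assms]] unfolding levi_civita_def by blast+

lemma levi_civitaI: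
  assumes "X \<in> VF" "Y \<in> VF" "W \<in> VF" "\<And>Z. Z \<in> VF \<Longrightarrow> koszul X Y Z = \<eta> W Z + \<eta> W Z"
  shows "levi_civita X Y = W"
  using assms by (intro eta_eqI2) (auto simp: levi_civita_koszul)

text \<open>The part of Koszul's expression that is antisymmetric in \<open>X\<close> and
  \<open>Y\<close> consists of the term \<open>\<eta> (lie_bracket X Y) Z\<close> alone.\<close>

lemma levi_civita_torsionless:
  assumes XY: "X \<in> VF" "Y \<in> VF"
  shows "levi_civita X Y = levi_civita Y X + lie_bracket X Y"
proof (rule levi_civitaI)
  fix Z assume Z: "Z \<in> VF"
  have "koszul X Y Z = koszul Y X Z + (\<eta> (lie_bracket X Y) Z + \<eta> (lie_bracket X Y) Z)"
    using XY Z by (simp add: koszul_def lie_antisym[of Y X] eta_sym[of Y X])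
  then show "koszul X Y Z = \<eta> (levi_civita Y X + lie_bracket X Y) Z
      + \<eta> (levi_civita Y X + lie_bracket X Y) Z"
    using XY Z levi_civita_koszul[OF XY(2,1) Z] by (simp add: algebra_simps)
qed (use XY in simp_all)

text \<open>Symmetrizing Koszul's expression in its last two arguments cancels every term except the
  derivative of \<open>\<eta> Y Z\<close> along \<open>X\<close>.\<close>

lemma levi_civita_metric:
  assumes XYZ: "X \<in> VF" "Y \<in> VF" "Z \<in> VF"
  shows "X (\<eta> Y Z) = \<eta> (levi_civita X Y) Z + \<eta> Y (levi_civita X Z)"
proof (rule double_cancel_fun)
  have "koszul X Y Z + koszul X Z Y = X (\<eta> Y Z) + X (\<eta> Y Z)"
    using XYZ by (simp add: koszul_def lie_antisym[of Z Y] eta_sym[of Z Y])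
  then show "X (\<eta> Y Z) + X (\<eta> Y Z) = \<eta> (levi_civita X Y) Z + \<eta> Y (levi_civita X Z)
      + (\<eta> (levi_civita X Y) Z + \<eta> Y (levi_civita X Z))"
    using XYZ levi_civita_koszul[of X Y Z] levi_civita_koszul[of X Z Y]
    by (simp add: eta_sym[of Y] algebra_simps)
qed

lemma levi_civita_add_right:
  assumes XYZ: "X \<in> VF" "Y \<in> VF" "Z \<in> VF"
  shows "levi_civita X (Y + Z) = levi_civita X Y + levi_civita X Z"
proof (rule levi_civitaI)
  fix W assume W: "W \<in> VF"
  have "koszul X (Y + Z) W = koszul X Y W + koszul X Z W"
    using XYZ W by (simp add: koszul_def lie_add_right lie_add_left XYZ[THEN vf_add] W[THEN vf_add])
  then show "koszul X (Y + Z) W = \<eta> (levi_civita X Y + levi_civita X Z) W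
      + \<eta> (levi_civita X Y + levi_civita X Z) W"
    using XYZ W by (simp add: levi_civita_koszul[symmetric])
qed (use XYZ in simp_all)

lemma levi_civita_smult_right:
  assumes XY: "X \<in> VF" "Y \<in> VF" and f: "f \<in> C"
  shows "levi_civita X (f \<cdot>\<^sub>v Y) = X f \<cdot>\<^sub>v Y + f \<cdot>\<^sub>v levi_civita X Y"
proof (rule levi_civitaI)
  fix W assume W: "W \<in> VF"
  \<comment> \<open>The term \<open>X f * \<eta> Y W\<close> arises twice, from the derivative of
    \<open>\<eta>\<close> and from the bracket of \<open>X\<close> with
    \<open>f \<cdot>\<^sub>v Y\<close>, while the two terms with \<open>W f\<close> cancel.\<close>
  have "koszul X (f \<cdot>\<^sub>v Y) W = f * koszul X Y W + (X f * \<eta> Y W + X f * \<eta> Y W)"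
    using XY W f by (simp add: koszul_def lie_smult_right lie_smult_left XY[THEN vf_mult] W[THEN vf_mult]
        XY[THEN vf_smooth] W[THEN vf_smooth] eta_sym[of Y X] algebra_simps)
  then show "koszul X (f \<cdot>\<^sub>v Y) W = \<eta> (X f \<cdot>\<^sub>v Y + f \<cdot>\<^sub>v levi_civita X Y) W
      + \<eta> (X f \<cdot>\<^sub>v Y + f \<cdot>\<^sub>v levi_civita X Y) W"
    using XY W f by (simp add: levi_civita_koszul[symmetric] vf_smooth[OF XY(1)] algebra_simps)
qed (use XY f vf_smooth[OF XY(1)] in simp_all)

text \<open>Linearity in the first argument follows from the second one by torsion-freeness.\<close>

lemma levi_civita_add_left:
  assumes XYZ: "X \<in> VF" "Y \<in> VF" "Z \<in> VF"
  shows "levi_civita (X + Y) Z = levi_civita X Z + levi_civita Y Z"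
  using XYZ levi_civita_torsionless[of "X + Y" Z] levi_civita_torsionless[of X Z]
    levi_civita_torsionless[of Y Z]
  by (simp add: levi_civita_add_right lie_add_left)

lemma levi_civita_smult_left:
  assumes XY: "X \<in> VF" "Y \<in> VF" and f: "f \<in> C"
  shows "levi_civita (f \<cdot>\<^sub>v X) Y = f \<cdot>\<^sub>v levi_civita X Y"
  using XY f levi_civita_torsionless[of "f \<cdot>\<^sub>v X" Y] levi_civita_torsionless[of X Y]
  by (simp add: levi_civita_smult_right lie_smult_left smult_add_right)

end

section \<open>Para-Hermitian structures and the D-bracket\<close>

locale para_hermitian_manifold = manifold M
  for M :: "('a, 'e::euclidean_space) manifold" +
  fixes \<eta> :: "'a vfield \<Rightarrow> 'a form1"
    and K :: "'a vfield \<Rightarrow> 'a vfield"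
  assumes para_hermitian: "para_hermitian M \<eta> K"
begin

sublocale pseudo_riemannian_manifold M \<eta>
  using para_hermitian by unfold_locales (simp add: para_hermitian_def almost_para_hermitian_def)

abbreviation "Tp \<equiv> plus_sections M K"
abbreviation "Tm \<equiv> minus_sections M K"

section \<open>The eigenbundles and their projections\<close>

lemma K_VF [simp]: "X \<in> VF \<Longrightarrow> K X \<in> VF"
  and K_K [simp]: "X \<in> VF \<Longrightarrow> K (K X) = X"
  and K_add [simp]: "X \<in> VF \<Longrightarrow> Y \<in> VF \<Longrightarrow> K (X + Y) = K X + K Y"
  and K_smult [simp]: "f \<in> C \<Longrightarrow> X \<in> VF \<Longrightarrow> K (f \<cdot>\<^sub>v X) = f \<cdot>\<^sub>v K X"
  and eta_K: "X \<in> VF \<Longrightarrow> Y \<in> VF \<Longrightarrow> \<eta> (K X) (K Y) = - \<eta> X Y"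
  using para_hermitian
  by (simp_all add: para_hermitian_def almost_para_hermitian_def bundle_maps_def)

lemma K_zero [simp]: "K 0 = 0"
  using K_add[of 0 0] by simp

lemma K_uminus [simp]: "X \<in> VF \<Longrightarrow> K (- X) = - K X"
  using K_add[of X "- X"] by (simp add: eq_neg_iff_add_eq_0 add.commute)

lemma K_diff [simp]: "X \<in> VF \<Longrightarrow> Y \<in> VF \<Longrightarrow> K (X - Y) = K X - K Y"
  using K_add[of X "- Y"] by simp

lemma smult_uminus: "f \<cdot>\<^sub>v (- X) = - (f \<cdot>\<^sub>v X)"
  by (simp add: fun_smult_def fun_eq_iff)

lemma Tp_VF [simp]: "X \<in> Tp \<Longrightarrow> X \<in> VF"
  and Tm_VF [simp]: "X \<in> Tm \<Longrightarrow> X \<in> VF"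
  by (simp_all add: plus_sections_def minus_sections_def)

lemma Tp_K: "X \<in> Tp \<Longrightarrow> K X = X"
  and Tm_K: "X \<in> Tm \<Longrightarrow> K X = - X"
  and TpI: "X \<in> VF \<Longrightarrow> K X = X \<Longrightarrow> X \<in> Tp"
  by (simp_all only: plus_sections_def minus_sections_def mem_Collect_eq)

lemma Tp_zero [simp]: "0 \<in> Tp"
  and Tp_add [simp]: "X \<in> Tp \<Longrightarrow> Y \<in> Tp \<Longrightarrow> X + Y \<in> Tp"
  and Tp_uminus [simp]: "X \<in> Tp \<Longrightarrow> - X \<in> Tp"
  and Tp_diff [simp]: "X \<in> Tp \<Longrightarrow> Y \<in> Tp \<Longrightarrow> X - Y \<in> Tp"
  and Tp_smult [simp]: "f \<in> C \<Longrightarrow> X \<in> Tp \<Longrightarrow> f \<cdot>\<^sub>v X \<in> Tp"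
  by (auto intro!: TpI simp: Tp_K)

lemma Tp_lie [simp]: "X \<in> Tp \<Longrightarrow> Y \<in> Tp \<Longrightarrow> lie_bracket X Y \<in> Tp"
  using para_hermitian by (simp add: para_hermitian_def involutive_def)

lemma minus_sections_neg: "minus_sections M (\<lambda>X. - K X) = Tp"
  and plus_sections_neg: "plus_sections M (\<lambda>X. - K X) = Tm"
  unfolding plus_sections_def minus_sections_def
  by (simp_all only: neg_equal_iff_equal minus_equation_iff[of "K _"] eq_commute[of "- _" "K _"])

text \<open>Exchanging the roles of the eigenbundles amounts to replacing \<open>K\<close> by \<open>- K\<close>.\<close>

lemma neg: "para_hermitian_manifold M \<eta> (\<lambda>X. - K X)"
proof
  show "para_hermitian M \<eta> (\<lambda>X. - K X)"
    using para_hermitian unfolding para_hermitian_def almost_para_hermitian_def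
    by (simp add: minus_sections_neg plus_sections_neg bundle_maps_def smult_uminus)
qed

lemma Tm_zero [simp]: "0 \<in> Tm"
  and Tm_add [simp]: "X \<in> Tm \<Longrightarrow> Y \<in> Tm \<Longrightarrow> X + Y \<in> Tm"
  and Tm_uminus [simp]: "X \<in> Tm \<Longrightarrow> - X \<in> Tm"
  and Tm_diff [simp]: "X \<in> Tm \<Longrightarrow> Y \<in> Tm \<Longrightarrow> X - Y \<in> Tm"
  and Tm_smult [simp]: "f \<in> C \<Longrightarrow> X \<in> Tm \<Longrightarrow> f \<cdot>\<^sub>v X \<in> Tm"
  and Tm_lie [simp]: "X \<in> Tm \<Longrightarrow> Y \<in> Tm \<Longrightarrow> lie_bracket X Y \<in> Tm"
proof -
  interpret neg: para_hermitian_manifold M \<eta> "\<lambda>X. - K X" by (rule neg)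
  show "0 \<in> Tm"
    and "X \<in> Tm \<Longrightarrow> Y \<in> Tm \<Longrightarrow> X + Y \<in> Tm"
    and "X \<in> Tm \<Longrightarrow> - X \<in> Tm"
    and "X \<in> Tm \<Longrightarrow> Y \<in> Tm \<Longrightarrow> X - Y \<in> Tm"
    and "f \<in> C \<Longrightarrow> X \<in> Tm \<Longrightarrow> f \<cdot>\<^sub>v X \<in> Tm"
    and "X \<in> Tm \<Longrightarrow> Y \<in> Tm \<Longrightarrow> lie_bracket X Y \<in> Tm"
    using neg.Tp_zero neg.Tp_add[of X Y] neg.Tp_uminus[of X] neg.Tp_diff[of X Y]
      neg.Tp_smult[of f X] neg.Tp_lie[of X Y] by (simp_all only: plus_sections_neg)
qed

text \<open>Both projections are instances of \<open>proj_plus\<close>, the second one for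
  \<open>- K\<close>, so that facts about one eigenbundle pass to the other by
  \<open>neg\<close>.\<close>

abbreviation "pp \<equiv> proj_plus K"
abbreviation "pm \<equiv> proj_plus (\<lambda>X. - K X)"

lemma pp_pm: "pp X + pm X = X"
  by (simp add: proj_plus_def fun_eq_iff field_simps)

lemma pp_double: "pp X + pp X = X + K X"
  by (simp add: proj_plus_def fun_eq_iff)

lemma pp_VF [simp]: "X \<in> VF \<Longrightarrow> pp X \<in> VF"
  using VF_half[of "X + K X"] by (simp add: proj_plus_def)

lemma pp_in [simp]:
  assumes "X \<in> VF" shows "pp X \<in> Tp"
proof -
  \<comment> \<open>Applying \<open>K\<close> to \<open>X + K X\<close> merely swaps the two
    summands.\<close>
  have "K (pp X) + K (pp X) = pp X + pp X"
    using assms K_add[of "pp X" "pp X"] K_add[of X "K X"] by (simp add: pp_double add.commute del: K_add)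
  then have "K (pp X) = pp X" by (rule double_cancel_vfield)
  with assms show ?thesis by (simp add: TpI)
qed

lemma pm_in [simp]: "X \<in> VF \<Longrightarrow> pm X \<in> Tm"
  using para_hermitian_manifold.pp_in[OF neg, of X] by (simp add: plus_sections_neg)

lemma pp_Tp [simp]: "X \<in> Tp \<Longrightarrow> pp X = X"
  and pp_Tm [simp]: "X \<in> Tm \<Longrightarrow> pp X = 0"
  and pm_Tp [simp]: "X \<in> Tp \<Longrightarrow> pm X = 0"
  and pm_Tm [simp]: "X \<in> Tm \<Longrightarrow> pm X = X"
  by (simp_all add: proj_plus_def Tp_K Tm_K fun_eq_iff)

lemma pp_add [simp]: "X \<in> VF \<Longrightarrow> Y \<in> VF \<Longrightarrow> pp (X + Y) = pp X + pp Y"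
  and pm_add [simp]: "X \<in> VF \<Longrightarrow> Y \<in> VF \<Longrightarrow> pm (X + Y) = pm X + pm Y"
  and pp_diff [simp]: "X \<in> VF \<Longrightarrow> Y \<in> VF \<Longrightarrow> pp (X - Y) = pp X - pp Y"
  and pm_diff [simp]: "X \<in> VF \<Longrightarrow> Y \<in> VF \<Longrightarrow> pm (X - Y) = pm X - pm Y"
  and pp_smult [simp]: "f \<in> C \<Longrightarrow> X \<in> VF \<Longrightarrow> pp (f \<cdot>\<^sub>v X) = f \<cdot>\<^sub>v pp X"
  and pm_smult [simp]: "f \<in> C \<Longrightarrow> X \<in> VF \<Longrightarrow> pm (f \<cdot>\<^sub>v X) = f \<cdot>\<^sub>v pm X"
  by (simp_all add: proj_plus_def fun_eq_iff field_simps)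

lemma split_VF:
  assumes "X \<in> VF"
  obtains a b where "a \<in> Tp" "b \<in> Tm" "X = a + b"
  using that[of "pp X" "pm X"] assms by (simp add: pp_pm)

text \<open>\<open>K\<close> fixes both arguments, so \<open>eta_K\<close> makes
  \<open>\<eta> X Y\<close> equal to its own negative.\<close>

lemma eta_Tp [simp]:
  assumes "X \<in> Tp" "Y \<in> Tp" shows "\<eta> X Y = 0"
proof -
  have "\<eta> X Y + \<eta> X Y = 0 + 0"
    using eta_K[of X Y] assms by (simp add: Tp_K eq_neg_iff_add_eq_0)
  then show ?thesis by (rule double_cancel_fun)
qed

lemma eta_Tm [simp]: "X \<in> Tm \<Longrightarrow> Y \<in> Tm \<Longrightarrow> \<eta> X Y = 0"
  using para_hermitian_manifold.eta_Tp[OF neg, of X Y] by (simp add: plus_sections_neg)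

lemma eta_pp [simp]: "X \<in> VF \<Longrightarrow> Y \<in> Tm \<Longrightarrow> \<eta> (pp X) Y = \<eta> X Y"
  using eta_add_left[of Y "pp X" "pm X"] by (simp add: pp_pm del: eta_add_left)

lemma eta_pm [simp]: "X \<in> VF \<Longrightarrow> Y \<in> Tp \<Longrightarrow> \<eta> (pm X) Y = \<eta> X Y"
  using eta_add_left[of Y "pp X" "pm X"] by (simp add: pp_pm del: eta_add_left)

text \<open>As \<open>Tm\<close> is isotropic, only pairings with \<open>Tp\<close> can distinguish
  its sections.\<close>

lemma Tm_eqI:
  assumes "X \<in> Tm" "Y \<in> Tm" "\<And>Z. Z \<in> Tp \<Longrightarrow> \<eta> X Z = \<eta> Y Z"
  shows "X = Y"
proof (rule eta_eqI)
  fix Z assume "Z \<in> VF"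
  then obtain a b where "a \<in> Tp" "b \<in> Tm" "Z = a + b" by (rule split_VF)
  then show "\<eta> X Z = \<eta> Y Z" using assms by simp
qed (use assms in simp_all)

lemma Tp_eqI: "X \<in> Tp \<Longrightarrow> Y \<in> Tp \<Longrightarrow> (\<And>Z. Z \<in> Tm \<Longrightarrow> \<eta> X Z = \<eta> Y Z) \<Longrightarrow> X = Y"
  using para_hermitian_manifold.Tm_eqI[OF neg, of X Y]
  by (simp add: plus_sections_neg minus_sections_neg)

section \<open>The canonical connection is adapted\<close>

definition canonical :: "'a vfield \<Rightarrow> 'a vfield \<Rightarrow> 'a vfield" where
  "canonical X Y = pp (levi_civita X (pp Y)) + pm (levi_civita X (pm Y))"

lemma levi_civita_zero_right [simp]: "X \<in> VF \<Longrightarrow> levi_civita X 0 = 0"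
  using levi_civita_add_right[of X 0 0] by simp

lemma canonical_Tp: "X \<in> VF \<Longrightarrow> Y \<in> Tp \<Longrightarrow> canonical X Y = pp (levi_civita X Y)"
  and canonical_Tm: "X \<in> VF \<Longrightarrow> Y \<in> Tm \<Longrightarrow> canonical X Y = pm (levi_civita X Y)"
  by (simp_all add: canonical_def)

lemma canonical_VF [simp]: "X \<in> VF \<Longrightarrow> Y \<in> VF \<Longrightarrow> canonical X Y \<in> VF"
  by (simp add: canonical_def)

lemma canonical_connection: "connection_on M VF canonical"
  unfolding connection_on_def bundle_maps_def
  by (auto simp: canonical_def levi_civita_add_left levi_civita_add_right levi_civita_smult_left
      levi_civita_smult_right smult_add_right vf_smooth algebra_simps) (simp add: pp_pm flip: add.assoc smult_add_right)

text \<open>Project torsion-freeness of the Levi-Civita connection to \<open>Tp\<close>: by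
  involutivity of \<open>Tp\<close> the bracket is fixed by the projection.\<close>

lemma canonical_torsionless:
  assumes "X \<in> Tp" "Y \<in> Tp" shows "torsion canonical X Y = 0"
  using assms levi_civita_torsionless[of X Y] by (simp add: torsion_def canonical_Tp)

text \<open>Condition (1) is inherited from the Levi-Civita connection and (2) is built into the
  definition. For (3) and (4) the torsion vanishes on \<open>Tp\<close>, and
  \<open>canonical Z X\<close> lies in the isotropic bundle \<open>Tp\<close>.\<close>

lemma canonical_half_adapted: "half_adapted M \<eta> Tp Tm canonical"
  unfolding half_adapted_def
proof (intro conjI ballI)
  fix X Y Z assume X: "X \<in> Tp" and YZ: "Y \<in> VF" "Z \<in> VF"
  obtain a b where "a \<in> Tp" "b \<in> Tm" "Y = a + b" using YZ(1) by (rule split_VF)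
  moreover obtain c d where "c \<in> Tp" "d \<in> Tm" "Z = c + d" using YZ(2) by (rule split_VF)
  \<comment> \<open>Only the mixed pairings of \<open>a\<close> with \<open>d\<close> and of
    \<open>b\<close> with \<open>c\<close> survive. In them the projections do not matter, so
    metricity of the Levi-Civita connection suffices.\<close>
  ultimately show "X (\<eta> Y Z) - \<eta> (canonical X Y) Z - \<eta> Y (canonical X Z) = 0"
    using X levi_civita_metric[of X a d] levi_civita_metric[of X b c]
    by (simp add: canonical_def vf_add[of X] eta_sym[of a] eta_sym[of b])
next
  fix X Y assume "X \<in> Tp" "Y \<in> Tm"
  then show "canonical X Y \<in> Tm" by (simp add: canonical_Tm)
next
  fix X Y Z assume XY: "X \<in> Tp" "Y \<in> Tp"
  show "\<eta> (torsion canonical X Y) Z = 0" if "Z \<in> Tm"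
    using XY that by (simp add: canonical_torsionless)
  show "\<eta> (torsion canonical X Y) Z + \<eta> (canonical Z X) Y = 0" if "Z \<in> Tp"
    using XY that by (simp add: canonical_torsionless canonical_Tp)
qed

text \<open>Replacing \<open>K\<close> by \<open>- K\<close> interchanges the two summands; hence
  the second half of the adaptedness conditions follows from the first.\<close>

lemma canonical_neg: "para_hermitian_manifold.canonical M \<eta> (\<lambda>X. - K X) = canonical"
proof -
  interpret neg: para_hermitian_manifold M \<eta> "\<lambda>X. - K X" by (rule neg)
  show ?thesis
    by (intro ext) (simp add: neg.canonical_def canonical_def add.commute)
qed

lemma canonical_torsionless_Tm: "X \<in> Tm \<Longrightarrow> Y \<in> Tm \<Longrightarrow> torsion canonical X Y = 0"
  using para_hermitian_manifold.canonical_torsionless[OF neg, of X Y]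
  by (simp add: canonical_neg plus_sections_neg)

lemma canonical_adapted: "adapted_connection M \<eta> K canonical"
  using para_hermitian_manifold.canonical_half_adapted[OF neg]
    canonical_half_adapted canonical_connection
  by (simp add: adapted_connection_def canonical_neg plus_sections_neg minus_sections_neg)

section \<open>The trilinear form of the D-bracket\<close>

definition D_form :: "('a vfield \<Rightarrow> 'a vfield \<Rightarrow> 'a vfield) \<Rightarrow> 'a vfield \<Rightarrow> 'a vfield \<Rightarrow> 'a form1" where
  "D_form D X Y Z = \<eta> (D X Y - D Y X) Z + \<eta> (D Z X) Y"

context
  fixes D assumes D: "adapted_connection M \<eta> K D"
begin

lemma D_VF [simp]: "X \<in> VF \<Longrightarrow> Y \<in> VF \<Longrightarrow> D X Y \<in> VF"
  and D_add_left: "X \<in> VF \<Longrightarrow> X' \<in> VF \<Longrightarrow> Y \<in> VF \<Longrightarrow> D (X + X') Y = D X Y + D X' Y"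
  and D_smult_left: "f \<in> C \<Longrightarrow> X \<in> VF \<Longrightarrow> Y \<in> VF \<Longrightarrow> D (f \<cdot>\<^sub>v X) Y = f \<cdot>\<^sub>v D X Y"
  and D_add_right: "X \<in> VF \<Longrightarrow> Y \<in> VF \<Longrightarrow> Y' \<in> VF \<Longrightarrow> D X (Y + Y') = D X Y + D X Y'"
  using D unfolding adapted_connection_def connection_on_def bundle_maps_def by simp_all

lemma half_adapted: "half_adapted M \<eta> Tp Tm D" "half_adapted M \<eta> Tm Tp D"
  using D unfolding adapted_connection_def by blast+

lemma D_metric:
  assumes "X \<in> Tp \<or> X \<in> Tm" "Y \<in> VF" "Z \<in> VF"
  shows "X (\<eta> Y Z) = \<eta> (D X Y) Z + \<eta> Y (D X Z)"
proof -
  have "X (\<eta> Y Z) - \<eta> (D X Y) Z - \<eta> Y (D X Z) = 0"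
    using half_adapted assms unfolding half_adapted_def by blast
  then show ?thesis by (simp add: algebra_simps)
qed

lemma D_preserves [simp]:
    "X \<in> Tp \<Longrightarrow> Y \<in> Tm \<Longrightarrow> D X Y \<in> Tm"
    "X \<in> Tm \<Longrightarrow> Y \<in> Tp \<Longrightarrow> D X Y \<in> Tp"
  using half_adapted unfolding half_adapted_def by blast+

lemma D_torsion:
  assumes "X \<in> Tp \<and> Y \<in> Tp \<and> Z \<in> Tm \<or> X \<in> Tm \<and> Y \<in> Tm \<and> Z \<in> Tp"
  shows "\<eta> (D X Y) Z - \<eta> (D Y X) Z = \<eta> (lie_bracket X Y) Z"
proof -
  have "\<eta> (torsion D X Y) Z = 0"
    using half_adapted assms unfolding half_adapted_def by blast
  moreover have "X \<in> VF" "Y \<in> VF" "Z \<in> VF"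
    using assms by auto
  ultimately show ?thesis by (simp add: torsion_def)
qed

text \<open>In condition (4) the bracket term drops out: \<open>lie_bracket X Y\<close> is again in
  \<open>Tp\<close>, hence orthogonal to \<open>Z\<close>.\<close>

lemma D_torsion':
  assumes "X \<in> Tp" "Y \<in> Tp" "Z \<in> Tp"
  shows "\<eta> (D X Y) Z - \<eta> (D Y X) Z + \<eta> (D Z X) Y = 0"
proof -
  have "\<eta> (torsion D X Y) Z + \<eta> (D Z X) Y = 0"
    using half_adapted assms unfolding half_adapted_def by blast
  with assms show ?thesis by (simp add: torsion_def)
qed

lemma D_form_add:
  assumes "X \<in> VF" "Y \<in> VF" "Z \<in> VF" "W \<in> VF"
  shows "D_form D (X + W) Y Z = D_form D X Y Z + D_form D W Y Z"
    and "D_form D X (Y + W) Z = D_form D X Y Z + D_form D X W Z"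
    and "D_form D X Y (Z + W) = D_form D X Y Z + D_form D X Y W"
  using assms by (simp_all add: D_form_def D_add_left D_add_right algebra_simps)

text \<open>On the \<open>Tp\<close> part of \<open>Z\<close> condition (4) makes both sides 0. On
  the \<open>Tm\<close> part, \<open>D Z X\<close> stays in \<open>Tp\<close> and pairs to 0 with
  \<open>Y\<close>, so condition (3) leaves the bracket.\<close>

lemma D_form_plus_plus:
  assumes XY: "X \<in> Tp" "Y \<in> Tp" and Z: "Z \<in> VF"
  shows "D_form D X Y Z = \<eta> (lie_bracket X Y) Z"
proof -
  obtain a b where Z: "a \<in> Tp" "b \<in> Tm" "Z = a + b" using Z by (rule split_VF)
  have "D_form D X Y a = 0" and "D_form D X Y b = \<eta> (lie_bracket X Y) b"
    using XY Z D_torsion'[of X Y a] D_torsion[of X Y b] by (simp_all add: D_form_def)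
  then show ?thesis using XY Z by (simp add: D_form_add)
qed

text \<open>\<open>D Y X\<close> lies in \<open>Tp\<close> and pairs to 0 with \<open>Z\<close>.
  Metricity moves \<open>D X\<close> from \<open>Y\<close> onto \<open>Z\<close>; condition (3) then
  joins the two remaining derivatives into a bracket.\<close>

lemma D_form_plus_minus_plus:
  assumes "X \<in> Tp" "Y \<in> Tm" "Z \<in> Tp"
  shows "D_form D X Y Z = X (\<eta> Y Z) - \<eta> (lie_bracket X Z) Y"
  using assms D_metric[of X Y Z] D_torsion[of X Z Y]
  by (simp add: D_form_def eta_sym[of Y] algebra_simps)

text \<open>\<open>D X Y\<close> lies in \<open>Tm\<close> and pairs to 0 with \<open>Z\<close>.
  Metricity moves both remaining derivatives off \<open>X\<close>, where they combine into a bracket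
  by condition (3) for \<open>Tm\<close>.\<close>

lemma D_form_plus_minus_minus:
  assumes "X \<in> Tp" "Y \<in> Tm" "Z \<in> Tm"
  shows "D_form D X Y Z = Z (\<eta> X Y) - Y (\<eta> X Z) + \<eta> (lie_bracket Y Z) X"
  using assms D_metric[of Y X Z] D_metric[of Z X Y] D_torsion[of Y Z X]
  by (simp add: D_form_def eta_sym[of X] algebra_simps)

end

lemma adapted_neg: "adapted_connection M \<eta> (\<lambda>X. - K X) D \<longleftrightarrow> adapted_connection M \<eta> K D"
  by (auto simp: adapted_connection_def plus_sections_neg minus_sections_neg)

lemma
  assumes "adapted_connection M \<eta> K D"
  shows D_form_minus_minus: "X \<in> Tm \<Longrightarrow> Y \<in> Tm \<Longrightarrow> Z \<in> VF \<Longrightarrow>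
      D_form D X Y Z = \<eta> (lie_bracket X Y) Z"
    and D_form_minus_plus_minus: "X \<in> Tm \<Longrightarrow> Y \<in> Tp \<Longrightarrow> Z \<in> Tm \<Longrightarrow>
      D_form D X Y Z = X (\<eta> Y Z) - \<eta> (lie_bracket X Z) Y"
    and D_form_minus_plus_plus: "X \<in> Tm \<Longrightarrow> Y \<in> Tp \<Longrightarrow> Z \<in> Tp \<Longrightarrow>
      D_form D X Y Z = Z (\<eta> X Y) - Y (\<eta> X Z) + \<eta> (lie_bracket Y Z) X"
proof -
  interpret neg: para_hermitian_manifold M \<eta> "\<lambda>X. - K X" by (rule neg)
  have D: "adapted_connection M \<eta> (\<lambda>X. - K X) D" using assms by (simp add: adapted_neg)
  show "X \<in> Tm \<Longrightarrow> Y \<in> Tm \<Longrightarrow> Z \<in> VF \<Longrightarrow> D_form D X Y Z = \<eta> (lie_bracket X Y) Z"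
    and "X \<in> Tm \<Longrightarrow> Y \<in> Tp \<Longrightarrow> Z \<in> Tm \<Longrightarrow> D_form D X Y Z = X (\<eta> Y Z) - \<eta> (lie_bracket X Z) Y"
    and "X \<in> Tm \<Longrightarrow> Y \<in> Tp \<Longrightarrow> Z \<in> Tp \<Longrightarrow>
      D_form D X Y Z = Z (\<eta> X Y) - Y (\<eta> X Z) + \<eta> (lie_bracket Y Z) X"
    using neg.D_form_plus_plus[OF D, of X Y Z] neg.D_form_plus_minus_plus[OF D, of X Y Z]
      neg.D_form_plus_minus_minus[OF D, of X Y Z]
    by (simp_all only: plus_sections_neg minus_sections_neg neg.D_form_def D_form_def)
qed

lemmas D_form_values = D_form_plus_plus D_form_plus_minus_plus D_form_plus_minus_minus
  D_form_minus_minus D_form_minus_plus_minus D_form_minus_plus_plus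

text \<open>By additivity it suffices to treat arguments from the eigenbundles, and none of the
  values found there mentions the connection.\<close>

lemma D_form_unique:
  assumes "adapted_connection M \<eta> K D" "adapted_connection M \<eta> K D'"
    and "X \<in> VF" "Y \<in> VF" "Z \<in> VF"
  shows "D_form D X Y Z = D_form D' X Y Z"
proof -
  obtain x x' where "x \<in> Tp" "x' \<in> Tm" "X = x + x'" using assms(3) by (rule split_VF)
  moreover obtain y y' where "y \<in> Tp" "y' \<in> Tm" "Y = y + y'" using assms(4) by (rule split_VF)
  moreover obtain z z' where "z \<in> Tp" "z' \<in> Tm" "Z = z + z'" using assms(5) by (rule split_VF)
  ultimately show ?thesis
    by (simp add: D_form_add[OF assms(1)] D_form_add[OF assms(2)]
        D_form_values[OF assms(1)] D_form_values[OF assms(2)])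
qed

text \<open>The third argument enters only as an argument of \<open>\<eta>\<close> and as the
  direction of differentiation, so the form is tensorial in it and is represented by a vector
  field.\<close>

lemma D_form_dual:
  assumes "X \<in> VF" "Y \<in> VF"
  shows "restrict_form VF (D_form canonical X Y) \<in> dual_sections M VF"
  using assms unfolding dual_sections_def restrict_form_def
  by (auto simp: D_form_def D_add_left[OF canonical_adapted] D_smult_left[OF canonical_adapted]
      distrib_left add_ac)

text \<open>The vector field representing the form of the canonical connection meets the definite
  description, and by \<open>D_form_unique\<close> any adapted connection leads to the same
  one.\<close>

lemma
  assumes "X \<in> VF" "Y \<in> VF"
  shows D_bracket_VF [simp]: "D_bracket M \<eta> K X Y \<in> VF"
    and eta_D_bracket: "Z \<in> VF \<Longrightarrow> \<eta> (D_bracket M \<eta> K X Y) Z = D_form canonical X Y Z"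
proof -
  obtain W where W: "W \<in> VF" "\<And>Z. Z \<in> VF \<Longrightarrow> \<eta> W Z = D_form canonical X Y Z"
    using eta_represent[OF D_form_dual[OF assms]] by (metis restrict_form_def)
  have "D_bracket M \<eta> K X Y = W"
    unfolding D_bracket_def D_form_def[symmetric]
  proof (rule the_equality)
    show "W \<in> VF \<and> (\<exists>D. adapted_connection M \<eta> K D \<and> (\<forall>Z\<in>VF. \<eta> W Z = D_form D X Y Z))"
      using W canonical_adapted by blast
    show "V = W"
      if "V \<in> VF \<and> (\<exists>D. adapted_connection M \<eta> K D \<and> (\<forall>Z\<in>VF. \<eta> V Z = D_form D X Y Z))" for V
      using that W D_form_unique[OF _ canonical_adapted assms] by (intro eta_eqI) auto
  qed
  with W show "D_bracket M \<eta> K X Y \<in> VF"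
    and "Z \<in> VF \<Longrightarrow> \<eta> (D_bracket M \<eta> K X Y) Z = D_form canonical X Y Z" by auto
qed

lemma D_bracket_Tm:
  assumes "X \<in> Tm" "Y \<in> Tm"
  shows "D_bracket M \<eta> K X Y = lie_bracket X Y"
  using assms by (intro eta_eqI) (simp_all add: eta_D_bracket D_form_minus_minus[OF canonical_adapted])

end

section \<open>B-transformations\<close>

locale b_transformation = para_hermitian_manifold M \<eta> K
  for M :: "('a, 'e::euclidean_space) manifold"
    and \<eta> :: "'a vfield \<Rightarrow> 'a form1" and K :: "'a vfield \<Rightarrow> 'a vfield" +
  fixes B :: "'a vfield \<Rightarrow> 'a vfield"
  assumes B_bundle_map: "B \<in> bundle_maps M Tp Tm"
    and B_skew: "X \<in> Tp \<Longrightarrow> Y \<in> Tp \<Longrightarrow> \<eta> (B X) Y = - \<eta> X (B Y)"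
begin

lemma B_Tm [simp]: "X \<in> Tp \<Longrightarrow> B X \<in> Tm"
  and B_add: "X \<in> Tp \<Longrightarrow> Y \<in> Tp \<Longrightarrow> B (X + Y) = B X + B Y"
  using B_bundle_map by (auto simp: bundle_maps_def)

lemma B_zero [simp]: "B 0 = 0"
  using B_add[of 0 0] by simp

lemma B_skew': "X \<in> Tp \<Longrightarrow> Y \<in> Tp \<Longrightarrow> \<eta> (B X) Y = - \<eta> (B Y) X"
  using B_skew[of X Y] by (simp add: eta_sym[of X])

section \<open>The eigenbundles of the B-transformation\<close>

lemma B_transform_split:
  assumes "X \<in> Tp" "Y \<in> Tm"
  shows "B_transform K B (X + Y) = X - Y + (B X + B X)"
  using assms by (simp add: B_transform_def exp_B_def Tp_K Tm_K algebra_simps)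

lemma mem_plus_B:
  assumes "X \<in> Tp" "Y \<in> Tm"
  shows "X + Y \<in> plus_sections M (B_transform K B) \<longleftrightarrow> Y = B X"
proof -
  have "X + Y \<in> plus_sections M (B_transform K B) \<longleftrightarrow> B X + B X = Y + Y"
    using assms by (auto simp: plus_sections_def[of M "B_transform K B"] B_transform_split algebra_simps)
  then show ?thesis
    by (metis double_cancel_vfield)
qed

lemma minus_B: "minus_sections M (B_transform K B) = Tm"
proof (intro set_eqI iffI)
  fix X assume X: "X \<in> minus_sections M (B_transform K B)"
  then have "X \<in> VF" by (simp add: minus_sections_def[of M "B_transform K B"])
  then obtain a b where ab: "a \<in> Tp" "b \<in> Tm" "X = a + b" by (rule split_VF)
  have "a - b + (B a + B a) = - (a + b)"
    using X ab by (simp add: minus_sections_def[of M "B_transform K B"] B_transform_split)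
  then have "a + a = - (B a + B a)"
    by (simp add: algebra_simps eq_neg_iff_add_eq_0)
  \<comment> \<open>The two sides of the preceding equation lie in \<open>Tp\<close> and
    \<open>Tm\<close> respectively; applying \<open>pp\<close> keeps the left one and kills the
    right one.\<close>
  moreover have "pp (a + a) = a + a" "pp (- (B a + B a)) = 0"
    by (rule pp_Tp[OF Tp_add[OF ab(1) ab(1)]],
        rule pp_Tm[OF Tm_uminus[OF Tm_add[OF B_Tm[OF ab(1)] B_Tm[OF ab(1)]]]])
  ultimately have "a + a = 0 + 0" by simp
  then have "a = 0" by (rule double_cancel_vfield)
  with ab show "X \<in> Tm" by simp
next
  fix X assume "X \<in> Tm"
  then show "X \<in> minus_sections M (B_transform K B)"
    using B_transform_split[of 0 X] by (simp add: minus_sections_def[of M "B_transform K B"])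
qed

text \<open>For \<open>W = a + b\<close>, skew-symmetry of \<open>B\<close> turns the pairing with
  \<open>Z + B Z\<close> into the pairing of \<open>b - B a\<close> with \<open>Z\<close>. Thus the
  graph of \<open>B\<close> is its own orthogonal complement.\<close>

lemma mem_plus_B_iff_orthogonal:
  assumes "W \<in> VF"
  shows "W \<in> plus_sections M (B_transform K B) \<longleftrightarrow> (\<forall>Z \<in> Tp. \<eta> W (Z + B Z) = 0)"
proof -
  obtain a b where ab: "a \<in> Tp" "b \<in> Tm" "W = a + b" using assms by (rule split_VF)
  have "\<eta> W (Z + B Z) = \<eta> b Z - \<eta> (B a) Z" if "Z \<in> Tp" for Z
    using ab that by (simp add: B_skew)
  moreover have "b = B a \<longleftrightarrow> (\<forall>Z \<in> Tp. \<eta> b Z = \<eta> (B a) Z)"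
    using ab Tm_eqI[of b "B a"] by auto
  ultimately show ?thesis
    using ab mem_plus_B[of a b] by simp
qed

section \<open>The bivector and its Schouten bracket\<close>

abbreviation "flat \<equiv> flat_plus M \<eta> K"
abbreviation "bm \<equiv> b_minus M \<eta> K B"

lemma flat_apply [simp]: "X \<in> Tm \<Longrightarrow> flat Y X = \<eta> Y X"
  and flat_outside: "X \<notin> Tm \<Longrightarrow> flat Y X = 0"
  by (simp_all add: flat_plus_def restrict_form_def)

lemma flat_dual [simp]: "X \<in> Tp \<Longrightarrow> flat X \<in> dual_sections M Tm"
  by (simp add: dual_sections_def flat_outside)

lemma flat_inj: "inj_on flat Tp"
proof (rule inj_onI)
  fix X Y assume "X \<in> Tp" "Y \<in> Tp" "flat X = flat Y"
  then show "X = Y" by (intro Tp_eqI) (auto simp flip: flat_apply)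
qed

lemma dual_Tm_flat:
  assumes "\<alpha> \<in> dual_sections M Tm"
  obtains X where "X \<in> Tp" "\<alpha> = flat X"
proof -
  \<comment> \<open>Precomposing with \<open>pm\<close> extends the form by zero along
    \<open>Tp\<close> to a one-form on the whole tangent bundle, where non-degeneracy
    applies.\<close>
  have "restrict_form VF (\<lambda>Z. \<alpha> (pm Z)) \<in> dual_sections M VF"
    using assms by (simp add: dual_sections_def restrict_form_def)
  then obtain W where W: "W \<in> VF" "\<And>Z. Z \<in> VF \<Longrightarrow> \<eta> W Z = restrict_form VF (\<lambda>Z. \<alpha> (pm Z)) Z"
    using eta_represent by blast
  have "\<alpha> Z = flat (pp W) Z" for Z
    using W assms by (cases "Z \<in> Tm") (simp_all add: restrict_form_def flat_outside dual_sections_def)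
  then show ?thesis
    using W by (intro that[of "pp W"]) auto
qed

lemma bm_flat [simp]: "X \<in> Tp \<Longrightarrow> Y \<in> Tp \<Longrightarrow> bm (flat X) (flat Y) = \<eta> (B X) Y"
  by (simp add: b_minus_def b_plus_def inv_into_f_f[OF flat_inj])

text \<open>Serves for forms that are not given as \<open>flat Y\<close>, such as covariant
  derivatives; by \<open>dual_Tm_flat\<close> they can be written so.\<close>

lemma bm_flat_left:
  assumes "\<alpha> \<in> dual_sections M Tm" "X \<in> Tp"
  shows "bm (flat X) \<alpha> = \<alpha> (B X)"
proof -
  obtain A where "A \<in> Tp" "\<alpha> = flat A" using assms(1) by (rule dual_Tm_flat)
  then show ?thesis using assms(2) by (simp add: eta_sym[of A])
qed

lemma bm_flat_right:
  assumes "\<alpha> \<in> dual_sections M Tm" "X \<in> Tp"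
  shows "bm \<alpha> (flat X) = - \<alpha> (B X)"
proof -
  obtain A where "A \<in> Tp" "\<alpha> = flat A" using assms(1) by (rule dual_Tm_flat)
  then show ?thesis using assms(2) by (simp add: B_skew)
qed

lemma contract_bm [simp]:
  assumes "X \<in> Tp" shows "contract M Tm bm (flat X) = B X"
  unfolding contract_def
proof (rule the_equality)
  show "B X \<in> Tm \<and> (\<forall>\<mu>\<in>dual_sections M Tm. \<mu> (B X) = bm (flat X) \<mu>)"
    using assms by (simp add: bm_flat_left)
  show "W = B X" if "W \<in> Tm \<and> (\<forall>\<mu>\<in>dual_sections M Tm. \<mu> W = bm (flat X) \<mu>)" for W
  proof (rule Tm_eqI)
    fix Z assume Z: "Z \<in> Tp"
    then have "flat Z W = bm (flat X) (flat Z)" using that flat_dual by blast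
    then show "\<eta> W Z = \<eta> (B X) Z" using conjunct1[OF that] assms Z by (simp add: eta_sym[of Z])
  qed (use that assms in simp_all)
qed

text \<open>Provides a witness for the existential quantifier in
  \<open>schouten_square\<close>.\<close>

lemma canonical_torsionless_connection: "torsionless_connection_on M Tm canonical"
proof -
  have "canonical X Y \<in> Tm" if "X \<in> Tm" "Y \<in> Tm" for X Y
    using that by (simp add: canonical_Tm)
  then show ?thesis
    using canonical_connection
    by (auto simp: torsionless_connection_on_def connection_on_def bundle_maps_def
        canonical_torsionless_Tm)
qed

context
  fixes D assumes D: "torsionless_connection_on M Tm D"
begin

lemma conn_Tm [simp]: "X \<in> Tm \<Longrightarrow> Y \<in> Tm \<Longrightarrow> D X Y \<in> Tm"
  and conn_add: "X \<in> Tm \<Longrightarrow> Y \<in> Tm \<Longrightarrow> Z \<in> Tm \<Longrightarrow> D X (Y + Z) = D X Y + D X Z"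
  and conn_smult: "f \<in> C \<Longrightarrow> X \<in> Tm \<Longrightarrow> Y \<in> Tm \<Longrightarrow> D X (f \<cdot>\<^sub>v Y) = X f \<cdot>\<^sub>v Y + f \<cdot>\<^sub>v D X Y"
  using D by (auto simp: torsionless_connection_on_def connection_on_def bundle_maps_def)

lemma conn_torsionless: "X \<in> Tm \<Longrightarrow> Y \<in> Tm \<Longrightarrow> D X Y - D Y X = lie_bracket X Y"
  using D by (simp add: torsionless_connection_on_def torsion_def)

lemma cov_form_apply:
  "Z \<in> Tm \<Longrightarrow> D X Z \<in> Tm \<Longrightarrow> cov_form Tm D X (flat Y) Z = X (\<eta> Y Z) - \<eta> Y (D X Z)"
  by (simp add: cov_form_def restrict_form_def)

text \<open>For a multiple of the argument by \<open>f\<close>, the terms with the derivative of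
  \<open>f\<close> along \<open>X\<close> from the function and from the connection cancel.\<close>

lemma cov_form_dual:
  assumes X: "X \<in> Tm" and Y: "Y \<in> Tp"
  shows "cov_form Tm D X (flat Y) \<in> dual_sections M Tm"
  using assms unfolding dual_sections_def
  by (auto simp: cov_form_apply conn_add conn_smult vf_simps[OF Tm_VF[OF X]] algebra_simps)
    (simp add: cov_form_def restrict_form_def)

text \<open>The derivative of \<open>\<eta> (B Y) Z\<close> along \<open>B X\<close> occurs once
  with sign plus, from the function, and twice with sign minus, from the two forms; this leaves a
  single minus sign.\<close>

lemma cov_bivector_bm:
  assumes "X \<in> Tp" "Y \<in> Tp" "Z \<in> Tp"
  shows "cov_bivector Tm D (B X) bm (flat Y) (flat Z)
    = \<eta> (D (B X) (B Y)) Z - \<eta> (D (B X) (B Z)) Y - B X (\<eta> (B Y) Z)"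
proof -
  have "bm (cov_form Tm D (B X) (flat Y)) (flat Z) = - (B X (\<eta> Y (B Z)) - \<eta> (D (B X) (B Z)) Y)"
    using assms by (simp add: bm_flat_right cov_form_dual cov_form_apply eta_sym[of Y "D _ _"])
  moreover have "bm (flat Y) (cov_form Tm D (B X) (flat Z)) = B X (\<eta> (B Y) Z) - \<eta> (D (B X) (B Y)) Z"
    using assms by (simp add: bm_flat_left cov_form_dual cov_form_apply eta_sym[of Z])
      (simp add: fun_eq_iff)
  moreover have "B X (\<eta> (B Y) Z) = - B X (\<eta> Y (B Z))"
    using assms by (simp add: B_skew[of Y Z] vf_uminus[of "B X"])
  ultimately show ?thesis
    using assms by (simp add: cov_bivector_def)
qed

end

text \<open>In the cyclic sum the derivatives pair up into differences such as
  \<open>D (B X) (B Y) - D (B Y) (B X)\<close>, which are Lie brackets as \<open>D\<close> is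
  torsionless. The result is free of \<open>D\<close>, so the definite description has a unique
  solution.\<close>

lemma schouten_square_bm:
  assumes "X \<in> Tp" "Y \<in> Tp" "Z \<in> Tp"
  shows "schouten_square M Tm bm (flat X) (flat Y) (flat Z)
    = \<eta> (lie_bracket (B X) (B Y)) Z + \<eta> (lie_bracket (B Y) (B Z)) X + \<eta> (lie_bracket (B Z) (B X)) Y
      - B X (\<eta> (B Y) Z) - B Y (\<eta> (B Z) X) - B Z (\<eta> (B X) Y)" (is "_ = ?S")
proof -
  have S: "cov_bivector Tm D (contract M Tm bm (flat X)) bm (flat Y) (flat Z)
      + cov_bivector Tm D (contract M Tm bm (flat Y)) bm (flat Z) (flat X)
      + cov_bivector Tm D (contract M Tm bm (flat Z)) bm (flat X) (flat Y) = ?S"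
    if D: "torsionless_connection_on M Tm D" for D
    using assms by (simp add: cov_bivector_bm[OF D] conn_Tm[OF D] conn_torsionless[OF D, symmetric])
  show ?thesis
    unfolding schouten_square_def
    using S canonical_torsionless_connection by (intro the_equality) auto
qed

text \<open>Each of the eight terms is evaluated by \<open>D_form_values\<close>. Those with all
  arguments in one eigenbundle vanish, because the bracket stays in that isotropic bundle.\<close>

lemma D_form_graph:
  assumes "X \<in> Tp" "Y \<in> Tp" "Z \<in> Tp"
  shows "D_form canonical (X + B X) (Y + B Y) (Z + B Z) = d_two_form (b_plus \<eta> B) X Y Z
    + schouten_square M Tm bm (flat X) (flat Y) (flat Z)"
proof -
  \<comment> \<open>Skew-symmetry is used to bring pairings into the shape
    \<open>\<eta> (B U) V\<close>; the instances below fix one orientation for each pair of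
    arguments.\<close>
  have skew: "\<eta> U (B V) = - \<eta> (B U) V" if "U \<in> Tp" "V \<in> Tp" for U V
    using that by (simp add: B_skew)
  note uminus = assms[THEN Tp_VF, THEN vf_uminus] assms[THEN B_Tm, THEN Tm_VF, THEN vf_uminus]
  show ?thesis
    using assms
    by (simp add: D_form_add[OF canonical_adapted] D_form_values[OF canonical_adapted]
        schouten_square_bm d_two_form_def b_plus_def skew uminus
        B_skew'[of Y X] B_skew'[of Z X] B_skew'[of Z Y]
        B_skew'[of X "lie_bracket _ _"] B_skew'[of Y "lie_bracket _ _"] B_skew'[of Z "lie_bracket _ _"]
        eta_sym[of X "B _"] eta_sym[of Y "B _"] eta_sym[of "lie_bracket _ _" "B _"]
        lie_antisym[of "B Z" "B X"])
qed

lemma compatible_iff: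
  "compatible M \<eta> K (B_transform K B) \<longleftrightarrow> (\<forall>X \<in> Tp. \<forall>Y \<in> Tp. \<forall>Z \<in> Tp.
    d_two_form (b_plus \<eta> B) X Y Z + schouten_square M Tm bm (flat X) (flat Y) (flat Z) = 0)"
proof -
  have graph: "plus_sections M (B_transform K B) = (\<lambda>X. X + B X) ` Tp"
  proof (intro set_eqI iffI)
    fix X assume X: "X \<in> plus_sections M (B_transform K B)"
    then have "X \<in> VF" by (simp add: plus_sections_def[of M "B_transform K B"])
    then obtain a b where "a \<in> Tp" "b \<in> Tm" "X = a + b" by (rule split_VF)
    with X show "X \<in> (\<lambda>X. X + B X) ` Tp" by (simp add: mem_plus_B)
  next
    fix X assume "X \<in> (\<lambda>X. X + B X) ` Tp"
    then show "X \<in> plus_sections M (B_transform K B)" by (auto simp: mem_plus_B)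
  qed
  have "involutive (D_bracket M \<eta> K) Tm"
    by (simp add: involutive_def D_bracket_Tm)
  \<comment> \<open>Self-orthogonality of the graph turns membership into vanishing of all pairings
    with \<open>Z + B Z\<close>, and these are the values of the three-form.\<close>
  moreover have "D_bracket M \<eta> K (X + B X) (Y + B Y) \<in> plus_sections M (B_transform K B) \<longleftrightarrow>
    (\<forall>Z \<in> Tp. d_two_form (b_plus \<eta> B) X Y Z + schouten_square M Tm bm (flat X) (flat Y) (flat Z) = 0)"
    if "X \<in> Tp" "Y \<in> Tp" for X Y
    using that by (simp add: mem_plus_B_iff_orthogonal eta_D_bracket D_form_graph del: eta_add_right)
  ultimately show ?thesis
    by (simp add: compatible_def minus_B) (simp add: graph involutive_def)
qed

end

theorem proposition5p6:
  fixes P :: "('a, 'e::euclidean_space) manifold"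
    and \<eta> :: "'a vfield \<Rightarrow> 'a vfield \<Rightarrow> ('a \<Rightarrow> real)"
    and K B :: "'a vfield \<Rightarrow> 'a vfield"
  assumes "smooth_manifold P"
    and "para_hermitian P \<eta> K"
    and "B \<in> bundle_maps P (plus_sections P K) (minus_sections P K)"
    and "\<And>X Y. X \<in> plus_sections P K \<Longrightarrow> Y \<in> plus_sections P K \<Longrightarrow> \<eta> (B X) Y = - \<eta> X (B Y)"
  shows "compatible P \<eta> K (B_transform K B) \<longleftrightarrow>
    (\<forall>X \<in> plus_sections P K. \<forall>Y \<in> plus_sections P K. \<forall>Z \<in> plus_sections P K.
       d_two_form (b_plus \<eta> B) X Y Z
       + schouten_square P (minus_sections P K) (b_minus P \<eta> K B)
           (flat_plus P \<eta> K X) (flat_plus P \<eta> K Y) (flat_plus P \<eta> K Z) = 0)"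
proof -
  interpret b_transformation P \<eta> K B
    using assms by unfold_locales
  show ?thesis by (rule compatible_iff)
qed

end
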